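(* For any triangle $\triangle_{ABC}$ in $\mathbb{R}^2$, fail points can occur only on the longest side $\Gamma$ (a side of maximal length). Moreover, every fail point lies on the subsegment of $\Gamma$ between the midpoint of $\Gamma$ and the foot of the altitude from the opposite vertex onto $\Gamma$.
   Context: $\triangle_{ABC}$ is the open (nondegenerate) triangle with vertices $A,B,C$. The torsion function of a planar domain $\Omega$ is the unique solution $u$ of $-\Delta u=1$ in $\Omega$, $u=0$ on $\partial\Omega$; on a triangle it is $C^1$ up to the closure. A fail point of $\Omega$ is a point of $\overline\Omega$ at which $|\nabla u|$ attains its maximum over $\overline{\Omega}$ (such points lie on $\partial\Omega$). If several sides have maximal length, the statement means that each fail point lies on some side $\Gamma$ of maximal length, and within the indicated (closed) subsegment of that side. *)

theory Defs
  imports "HOL-Analysis.Analysis"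
begin

definition open_triangle :: "real^2 \<Rightarrow> real^2 \<Rightarrow> real^2 \<Rightarrow> (real^2) set"
  where "open_triangle A B C = interior (convex hull {A, B, C})"

definition gradient :: "(real^2 \<Rightarrow> real) \<Rightarrow> real^2 \<Rightarrow> real^2"
  where "gradient u x = (\<chi> i. frechet_derivative u (at x) (axis i 1))"

lemma gradient_eqI:
  assumes "GDERIV u x :> D"
  shows "gradient u x = D"
proof -
  have "(u has_derivative (\<lambda>h. inner h D)) (at x)"
    using assms by (simp add: gderiv_def)
  then have "frechet_derivative u (at x) = (\<lambda>h. inner h D)"
    by (metis frechet_derivative_at)
  then show ?thesis
    by (simp add: gradient_def vec_eq_iff inner_axis')
qed

definition laplacian :: "(real^2 \<Rightarrow> real) \<Rightarrow> real^2 \<Rightarrow> real"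
  where "laplacian u x = (\<Sum>i\<in>UNIV. frechet_derivative (gradient u) (at x) (axis i 1) $ i)"

definition C2_on :: "(real^2) set \<Rightarrow> (real^2 \<Rightarrow> real) \<Rightarrow> bool"
  where "C2_on \<Omega> u \<longleftrightarrow>
    (\<forall>x\<in>\<Omega>. u differentiable (at x)) \<and>
    (\<forall>x\<in>\<Omega>. gradient u differentiable (at x)) \<and>
    (\<forall>v. continuous_on \<Omega> (\<lambda>x. frechet_derivative (gradient u) (at x) v))"

definition torsion_function :: "(real^2) set \<Rightarrow> (real^2 \<Rightarrow> real) \<Rightarrow> bool"
  where "torsion_function \<Omega> u \<longleftrightarrow>
    continuous_on (closure \<Omega>) u \<and> C2_on \<Omega> u \<and>
    (\<forall>x\<in>\<Omega>. - laplacian u x = 1) \<and>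
    (\<forall>x\<in>frontier \<Omega>. u x = 0)"

text \<open>
  The torsion function of a bounded domain is unique on the closure, so the
  quantifier over \<open>u\<close> only names it. Boundary values of the gradient are those of
  its continuous extension \<open>G\<close> to the closure, which is unique as well. The
  maximum of the norm is taken over the whole closure; that it is attained on the
  frontier is not built in.
\<close>

definition fail_point :: "(real^2) set \<Rightarrow> real^2 \<Rightarrow> bool"
  where "fail_point \<Omega> p \<longleftrightarrow>
    (\<exists>u G. torsion_function \<Omega> u \<and>
      continuous_on (closure \<Omega>) G \<and> (\<forall>x\<in>\<Omega>. G x = gradient u x) \<and>
      p \<in> closure \<Omega> \<and> (\<forall>q\<in>closure \<Omega>. norm (G q) \<le> norm (G p)))"

definition altitude_foot :: "real^2 \<Rightarrow> real^2 \<Rightarrow> real^2 \<Rightarrow> real^2 \<Rightarrow> bool"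
  where "altitude_foot R P Q H \<longleftrightarrow>
    H \<in> affine hull {P, Q} \<and> orthogonal (R - H) (Q - P)"

end

theory Submission
  imports Defs "HOL-Complex_Analysis.Complex_Analysis"
begin

text \<open>
  Identify the plane with \<open>\<complex>\<close>. Since \<open>u + \<bar>z\<bar>\<^sup>2 / 4\<close> is harmonic, \<open>u\<close> differs from the real part of a
  holomorphic function by \<open>\<bar>z\<bar>\<^sup>2 / 4\<close>, and so the maximum modulus principle serves as strong maximum
  principle, both for \<open>u\<close> and for its directional derivatives; the latter puts the fail points on the
  boundary. Cut a cap off the triangle by a line and reflect it: if the reflected cap stays in
  the closed triangle, then \<open>u(z) - u(\<sigma> z)\<close> is harmonic and nonnegative in it, and Hopf's boundary
  lemma shows that the normal derivative at \<open>\<sigma> p\<close> is strictly larger than that at \<open>p\<close>. Reflection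
  in an angle bisector excludes the sides that are shorter than a neighbour; reflection in a perpendicular to the side
  excludes the part of the side on the far side of both the midpoint and the foot.
\<close>

text \<open>On a side \<open>U\<close> vanishes, so the gradient there is normal and its norm is the
  inward normal derivative; this is why comparing normal derivatives at mirror points compares the
  norms of the gradients. At a vertex two independent tangential derivatives vanish, so the gradient
  is zero there and vertices drop out. The difference of \<open>U\<close> and its mirror image is
  harmonic because a reflection is an isometry: the two quadratic terms differ by an affine function
  only. Its strict positivity, which Hopf's lemma needs, comes from one point of the reflected cap
  boundary that is interior to the triangle. The midpoint and the foot bound the admissible
  perpendicular cuts for different reasons: beyond the midpoint the mirror image of the vertex
  leaves the side, and beyond the foot the mirror line no longer meets the adjacent side. The
  gradient on the boundary is given only as a continuous extension from the interior, so its link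
  with the difference quotients of \<open>U\<close> at boundary points has to be proved; convexity
  makes this a mean value argument.\<close>

section \<open>Minimum principles and second derivatives\<close>

text \<open>Since |exp(-W)| = exp(-Re W), a minimum of Re W is a maximum of the modulus of a
  holomorphic function, which is then constant.\<close>

lemma harmonic_strong_min:
  assumes W: "W holomorphic_on S" and S: "open S" "connected S" and z0: "z0 \<in> S"
    and min: "\<And>z. z \<in> S \<Longrightarrow> Re (W z0) \<le> Re (W z)" and z: "z \<in> S"
  shows "Re (W z) = Re (W z0)"
proof -
  have "(\<lambda>z. exp (- W z)) constant_on S"
  proof (rule maximum_modulus_principle[of _ S S z0])
    show "(\<lambda>z. exp (- W z)) holomorphic_on S"
      by (intro holomorphic_intros W)
  qed (use S z0 min in auto)
  then have "exp (- W z) = exp (- W z0)"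
    using z z0 by (auto simp: constant_on_def)
  then have "norm (exp (- W z)) = norm (exp (- W z0))"
    by simp
  then show ?thesis
    by simp
qed

text \<open>An interior minimum makes \<open>w\<close> constant on the interior, hence by density on
  all of \<open>K\<close>, so the minimal value is also taken on the frontier.\<close>

lemma harmonic_weak_min:
  fixes K :: "complex set"
  assumes K: "compact K" "convex K" and ne: "interior K \<noteq> {}" and w: "continuous_on K w"
    and W: "W holomorphic_on interior K" and wW: "\<And>z. z \<in> interior K \<Longrightarrow> w z = Re (W z)"
    and fr: "\<And>z. z \<in> frontier K \<Longrightarrow> 0 \<le> w z" and z: "z \<in> K"
  shows "0 \<le> w z"
proof -
  obtain z0 where z0: "z0 \<in> K" and min: "\<And>y. y \<in> K \<Longrightarrow> w z0 \<le> w y"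
    using continuous_attains_inf[OF K(1) _ w] z by auto
  have cl: "closure (interior K) = K"
    using K by (simp add: convex_closure_interior[OF _ ne] compact_imp_closed)
  have "0 \<le> w z0"
  proof (cases "z0 \<in> interior K")
    case True
    have eq: "w y = w z0" if "y \<in> interior K" for y
      using harmonic_strong_min[OF W _ _ True _ that] K True min that wW interior_subset
      by (metis convex_connected convex_interior open_interior subsetD)
    obtain y where y: "y \<in> frontier K"
      using z K by (metis all_not_in_conv compact_imp_bounded frontier_eq_empty not_bounded_UNIV)
    then have "y \<in> K"
      using K by (metis compact_imp_closed frontier_subset_closed subsetD)
    then have "w y = w z0"
      using continuous_constant_on_closure[of "interior K" w "w z0" y] cl w eq by auto
    then show ?thesis
      using fr[OF y] by simp
  next
    case False
    then show ?thesis
      using fr z0 K by (simp add: frontier_def compact_imp_closed)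
  qed
  then show ?thesis
    using min[OF z] by simp
qed

text \<open>An interior zero would be a minimum; \<open>w\<close> would then vanish on the interior
  and, by density, at \<open>y\<close>, which may itself lie on the frontier.\<close>

lemma harmonic_pos:
  fixes K :: "complex set"
  assumes K: "compact K" "convex K" and w: "continuous_on K w"
    and W: "W holomorphic_on interior K" and wW: "\<And>z. z \<in> interior K \<Longrightarrow> w z = Re (W z)"
    and fr: "\<And>z. z \<in> frontier K \<Longrightarrow> 0 \<le> w z"
    and y: "y \<in> K" "0 < w y" and z: "z \<in> interior K"
  shows "0 < w z"
proof (rule ccontr)
  have ne: "interior K \<noteq> {}"
    using z by auto
  have nn: "0 \<le> w x" if "x \<in> K" for x
    using harmonic_weak_min[OF K ne w W wW fr that] .
  assume "\<not> 0 < w z"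
  then have wz: "w z = 0"
    using nn z interior_subset by (metis less_eq_real_def subsetD)
  have "w x = 0" if x: "x \<in> interior K" for x
  proof -
    have "Re (W x) = Re (W z)"
    proof (rule harmonic_strong_min[OF W _ _ z _ x])
      show "Re (W z) \<le> Re (W v)" if "v \<in> interior K" for v
        using that nn wz wW[OF z] wW[OF that] interior_subset by (metis subsetD)
    qed (use K in \<open>auto intro: convex_connected convex_interior\<close>)
    then show ?thesis
      using wz wW x z by simp
  qed
  moreover have "closure (interior K) = K"
    using K by (simp add: convex_closure_interior[OF _ ne] compact_imp_closed)
  ultimately have "w y = 0"
    using continuous_constant_on_closure[of "interior K" w 0 y] w y by auto
  with y show False by simp
qed

text \<open>Near \<open>p\<close> the gradient differs little from \<open>g p\<close>, so the mean
  value inequality bounds the linearisation error between interior points; continuity of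
  \<open>u\<close> carries the bound to the boundary.\<close>

lemma has_derivative_within_closure:
  fixes u :: "'a::euclidean_space \<Rightarrow> real"
  assumes K: "convex K" "closed K" and ne: "interior K \<noteq> {}"
    and u: "continuous_on K u" and g: "continuous_on K g"
    and der: "\<And>x. x \<in> interior K \<Longrightarrow> (u has_derivative (\<lambda>h. h \<bullet> g x)) (at x)"
    and p: "p \<in> K"
  shows "(u has_derivative (\<lambda>h. h \<bullet> g p)) (at p within K)"
  unfolding has_derivative_within_alt
proof (intro conjI allI impI)
  show "bounded_linear (\<lambda>h. h \<bullet> g p)"
    by (rule bounded_linear_inner_left)
  fix e :: real assume e: "0 < e"
  obtain d where d: "d > 0" and gd: "\<And>x. x \<in> K \<Longrightarrow> dist x p < d \<Longrightarrow> dist (g x) (g p) < e"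
    using g p e by (metis continuous_on_iff)
  obtain z0 where z0: "z0 \<in> interior K"
    using ne by auto
  have int: "norm (u y - u x - (y - x) \<bullet> g p) \<le> norm (y - x) * e"
    if xy: "x \<in> interior K \<inter> ball p d" "y \<in> interior K \<inter> ball p d" for x y
  proof -
    let ?S = "interior K \<inter> ball p d"
    have cS: "convex ?S"
      using K by (simp add: convex_Int convex_interior)
    define v where "v x = u x - x \<bullet> g p" for x
    have "norm (v y - v x) \<le> e * norm (y - x)"
    proof (rule differentiable_bound[OF cS])
      fix s assume s: "s \<in> ?S"
      then have "(u has_derivative (\<lambda>h. h \<bullet> g s)) (at s within ?S)"
        using der by (auto intro: has_derivative_at_withinI)
      then show "(v has_derivative (\<lambda>h. h \<bullet> g s - h \<bullet> g p)) (at s within ?S)"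
        unfolding v_def by (auto intro!: derivative_eq_intros)
      show "onorm (\<lambda>h. h \<bullet> g s - h \<bullet> g p) \<le> e"
      proof (rule onorm_le)
        fix h
        have "norm (h \<bullet> g s - h \<bullet> g p) \<le> norm h * norm (g s - g p)"
          by (metis Cauchy_Schwarz_ineq2 inner_diff_right real_norm_def)
        also have "\<dots> \<le> norm h * e"
          using gd[of s] s subsetD[OF interior_subset, of s K]
          by (intro mult_left_mono) (auto simp: dist_norm norm_minus_commute less_imp_le)
        finally show "norm (h \<bullet> g s - h \<bullet> g p) \<le> e * norm h"
          by (simp add: mult.commute)
      qed
    qed (use xy in auto)
    then show ?thesis
      by (simp add: v_def inner_diff_left algebra_simps)
  qed
  have "norm (u y - u p - (y - p) \<bullet> g p) \<le> e * norm (y - p)" if y: "y \<in> K" "norm (y - p) < d" for y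
  proof -
    \<comment> \<open>Shrinking towards the interior point \<open>z0\<close> moves every point of
      \<open>K\<close> into the interior; letting the parameter tend to 0 transfers
      \<open>int\<close> to the pair \<open>y\<close>, \<open>p\<close>.\<close>
    define sh where "sh x s = x - s *\<^sub>R (x - z0)" for x s
    have shK: "sh x s \<in> interior K" if "x \<in> K" "0 < s" "s \<le> 1" for x s
      unfolding sh_def using K that z0
      by (intro mem_interior_closure_convex_shrink) (auto simp: closure_closed)
    have lim: "((\<lambda>s. sh x s) \<longlongrightarrow> x) (at_right 0)" for x
      unfolding sh_def by (auto intro!: tendsto_eq_intros)
    have ev: "\<forall>\<^sub>F s in at_right 0. sh x s \<in> interior K \<inter> ball p d" if x: "x \<in> K" "x \<in> ball p d" for x
    proof -
      have "\<forall>\<^sub>F s in at_right 0. sh x s \<in> ball p d"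
        using topological_tendstoD[OF lim, of "ball p d"] x by auto
      moreover have "\<forall>\<^sub>F s in at_right (0::real). s < 1"
        by (rule eventually_at_rightI[of 0 1]) auto
      ultimately show ?thesis
        using eventually_at_right_less[of "0::real"]
      proof eventually_elim
        case (elim s) then show ?case using shK[of x s] x by auto
      qed
    qed
    have lu: "((\<lambda>s. u (sh x s)) \<longlongrightarrow> u x) (at_right 0)" if x: "x \<in> K" "x \<in> ball p d" for x
    proof (rule continuous_on_tendsto_compose[OF u lim x(1)])
      show "\<forall>\<^sub>F s in at_right 0. sh x s \<in> K"
        using ev[OF x] by eventually_elim (use interior_subset in auto)
    qed
    have yb: "y \<in> ball p d" and pb: "p \<in> ball p d"
      using y d by (auto simp: dist_norm norm_minus_commute)
    have "norm (u y - u p - (y - p) \<bullet> g p) \<le> norm (y - p) * e"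
    proof (rule tendsto_le[OF trivial_limit_at_right_real])
      show "((\<lambda>s. norm (u (sh y s) - u (sh p s) - (sh y s - sh p s) \<bullet> g p)) \<longlongrightarrow> norm (u y - u p - (y - p) \<bullet> g p)) (at_right 0)"
        by (intro tendsto_intros lu lim y p yb pb)
      show "((\<lambda>s. norm (sh y s - sh p s) * e) \<longlongrightarrow> norm (y - p) * e) (at_right 0)"
        by (intro tendsto_intros lim)
      show "\<forall>\<^sub>F s in at_right 0. norm (u (sh y s) - u (sh p s) - (sh y s - sh p s) \<bullet> g p) \<le> norm (sh y s - sh p s) * e"
        using ev[OF y(1) yb] ev[OF p pb] by eventually_elim (use int in auto)
    qed
    then show ?thesis by (simp add: mult.commute)
  qed
  with d show "\<exists>d>0. \<forall>y\<in>K. norm (y - p) < d \<longrightarrow> norm (u y - u p - (y - p) \<bullet> g p) \<le> e * norm (y - p)"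
    by blast
qed

text \<open>The second difference of \<open>u\<close> is symmetric in \<open>h\<close> and
  \<open>k\<close>. The mean value theorem along \<open>h\<close>, followed by linearising
  \<open>g\<close> at \<open>p\<close>, shows that it equals t^2 (h \<bullet> D k) + o(t^2), so the
  two mixed terms agree. Differentiability of \<open>g\<close> at the single point \<open>p\<close>
  suffices.\<close>

lemma symmetric_second_derivative:
  fixes u :: "'a::real_inner \<Rightarrow> real"
  assumes T: "open T" "p \<in> T"
    and u: "\<And>x. x \<in> T \<Longrightarrow> (u has_derivative (\<lambda>h. h \<bullet> g x)) (at x)"
    and g: "(g has_derivative D) (at p)"
  shows "h \<bullet> D k = k \<bullet> D h"
proof -
  interpret D: bounded_linear D
    using g by (rule has_derivative_bounded_linear)
  define \<Delta> where "\<Delta> h k t = u (p + t *\<^sub>R h + t *\<^sub>R k) - u (p + t *\<^sub>R h) - u (p + t *\<^sub>R k) + u p" for h k t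
  have key: "\<exists>d>0. \<forall>t. 0 < t \<and> t < d \<longrightarrow> \<bar>\<Delta> h k t - t\<^sup>2 * (h \<bullet> D k)\<bar> \<le> e * t\<^sup>2" if e: "0 < e" for e h k
  proof -
    define N where "N = norm h + norm k + 1"
    have N: "N > 0" "norm h \<le> N" "norm k \<le> N" "norm h + norm k \<le> N"
      by (auto simp: N_def add_nonneg_pos)
    \<comment> \<open>Two remainders of size at most \<open>e' * (t * N)\<close>, multiplied by
      \<open>t\<close> and a vector of norm at most \<open>N\<close>, must add up to
      \<open>e * t\<^sup>2\<close>.\<close>
    define e' where "e' = e / (2 * N * N)"
    have e': "e' > 0" using e N by (simp add: e'_def)
    obtain d1 where d1: "d1 > 0"
      and gd: "\<And>y. norm (y - p) < d1 \<Longrightarrow> norm (g y - g p - D (y - p)) \<le> e' * norm (y - p)"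
      using g e' unfolding has_derivative_within_alt by (metis UNIV_I)
    obtain d2 where d2: "d2 > 0" "ball p d2 \<subseteq> T"
      using T openE by blast
    define d where "d = min d1 d2 / N"
    have d: "d > 0" using d1 d2 N by (simp add: d_def)
    have "\<bar>\<Delta> h k t - t\<^sup>2 * (h \<bullet> D k)\<bar> \<le> e * t\<^sup>2" if t: "0 < t" "t < d" for t
    proof -
      have tN: "t * N < d1" "t * N < d2"
        using t N by (auto simp: d_def pos_less_divide_eq)
      have nb: "norm (s *\<^sub>R h + r *\<^sub>R k) \<le> t * N" if "0 \<le> s" "s \<le> t" "0 \<le> r" "r \<le> t" for s r
      proof -
        have "norm (s *\<^sub>R h + r *\<^sub>R k) \<le> s * norm h + r * norm k"
          using that by (metis abs_of_nonneg norm_scaleR norm_triangle_ineq)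
        also have "\<dots> \<le> t * norm h + t * norm k"
          using that by (intro add_mono mult_right_mono) auto
        also have "\<dots> \<le> t * N"
          using t N by (metis distrib_left less_imp_le mult_left_mono)
        finally show ?thesis .
      qed
      have inT: "p + s *\<^sub>R h + r *\<^sub>R k \<in> T" if "0 \<le> s" "s \<le> t" "0 \<le> r" "r \<le> t" for s r
        using nb[OF that] tN d2 by (auto simp: dist_norm subset_iff add.assoc norm_minus_commute)
      define \<phi> where "\<phi> s = u (p + s *\<^sub>R h + t *\<^sub>R k) - u (p + s *\<^sub>R h)" for s
      have der: "(\<phi> has_real_derivative h \<bullet> (g (p + s *\<^sub>R h + t *\<^sub>R k) - g (p + s *\<^sub>R h))) (at s)"
        if s: "0 \<le> s" "s \<le> t" for s
      proof -
        have "((\<lambda>s. u (p + s *\<^sub>R h + r *\<^sub>R k)) has_derivative (\<lambda>x. (x *\<^sub>R h) \<bullet> g (p + s *\<^sub>R h + r *\<^sub>R k))) (at s)"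
          if "0 \<le> r" "r \<le> t" for r
        proof (rule has_derivative_compose[where f = "\<lambda>s. p + s *\<^sub>R h + r *\<^sub>R k" and g = u])
          show "(u has_derivative (\<lambda>x. x \<bullet> g (p + s *\<^sub>R h + r *\<^sub>R k))) (at (p + s *\<^sub>R h + r *\<^sub>R k))"
            by (rule u[OF inT[OF s that]])
        qed (auto intro!: derivative_eq_intros)
        from this[of t] this[of 0] t
        have "(\<phi> has_derivative (\<lambda>x. (x *\<^sub>R h) \<bullet> g (p + s *\<^sub>R h + t *\<^sub>R k) - (x *\<^sub>R h) \<bullet> g (p + s *\<^sub>R h))) (at s)"
          unfolding \<phi>_def by (auto intro!: has_derivative_diff)
        then show ?thesis
          unfolding has_field_derivative_def by (rule has_derivative_eq_rhs) (auto simp: algebra_simps inner_diff_right)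
      qed
      obtain s where s: "0 < s" "s < t"
        and "\<phi> t - \<phi> 0 = (t - 0) * (h \<bullet> (g (p + s *\<^sub>R h + t *\<^sub>R k) - g (p + s *\<^sub>R h)))"
        using MVT2[OF t(1), of \<phi> "\<lambda>s. h \<bullet> (g (p + s *\<^sub>R h + t *\<^sub>R k) - g (p + s *\<^sub>R h))"] der
        by metis
      then have eq: "\<Delta> h k t = t * (h \<bullet> (g (p + s *\<^sub>R h + t *\<^sub>R k) - g (p + s *\<^sub>R h)))"
        by (simp add: \<Delta>_def \<phi>_def)
      define R where "R x = g (p + x) - g p - D x" for x
      have R: "norm (R x) \<le> e' * (t * N)" if "norm x \<le> t * N" for x
      proof -
        have "norm (R x) \<le> e' * norm x"
          using gd[of "p + x"] that tN by (simp add: R_def)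
        also have "\<dots> \<le> e' * (t * N)"
          using that e' by simp
        finally show ?thesis .
      qed
      have "g (p + s *\<^sub>R h + t *\<^sub>R k) - g (p + s *\<^sub>R h) = R (s *\<^sub>R h + t *\<^sub>R k) - R (s *\<^sub>R h) + t *\<^sub>R D k"
        by (simp add: R_def D.add D.scaleR add.assoc)
      then have "\<Delta> h k t - t\<^sup>2 * (h \<bullet> D k) = t * (h \<bullet> (R (s *\<^sub>R h + t *\<^sub>R k) - R (s *\<^sub>R h)))"
        unfolding eq by (simp only: inner_add_right inner_scaleR_right) (simp add: algebra_simps power2_eq_square)
      also have "\<bar>\<dots>\<bar> \<le> t * (norm h * norm (R (s *\<^sub>R h + t *\<^sub>R k) - R (s *\<^sub>R h)))"
        using t by (simp add: abs_mult Cauchy_Schwarz_ineq2)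
      also have "norm (R (s *\<^sub>R h + t *\<^sub>R k) - R (s *\<^sub>R h)) \<le> e' * (t * N) + e' * (t * N)"
        using t s nb[of s t] nb[of s 0] R[of "s *\<^sub>R h + t *\<^sub>R k"] R[of "s *\<^sub>R h"]
        by (intro order_trans[OF norm_triangle_ineq4] add_mono) auto
      then have "t * (norm h * norm (R (s *\<^sub>R h + t *\<^sub>R k) - R (s *\<^sub>R h))) \<le> t * (N * (e' * (t * N) + e' * (t * N)))"
        using t N by (intro mult_left_mono mult_mono) auto
      also have "\<dots> = e * t\<^sup>2"
        using N by (simp add: e'_def field_simps power2_eq_square)
      finally show ?thesis .
    qed
    with d show ?thesis by blast
  qed
  have "\<bar>h \<bullet> D k - k \<bullet> D h\<bar> \<le> 0"
  proof (rule field_le_epsilon)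
    fix e :: real assume "0 < e"
    then have e2: "0 < e / 2" by simp
    obtain d1 where d1: "d1 > 0" "\<And>t. 0 < t \<Longrightarrow> t < d1 \<Longrightarrow> \<bar>\<Delta> h k t - t\<^sup>2 * (h \<bullet> D k)\<bar> \<le> e/2 * t\<^sup>2"
      using key[OF e2] by metis
    obtain d2 where d2: "d2 > 0" "\<And>t. 0 < t \<Longrightarrow> t < d2 \<Longrightarrow> \<bar>\<Delta> k h t - t\<^sup>2 * (k \<bullet> D h)\<bar> \<le> e/2 * t\<^sup>2"
      using key[OF e2] by metis
    define t where "t = min d1 d2 / 2"
    have t: "0 < t" "t < d1" "t < d2" using d1 d2 by (auto simp: t_def)
    have "\<Delta> h k t = \<Delta> k h t"
      by (simp add: \<Delta>_def algebra_simps)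
    then have "\<bar>t\<^sup>2 * (h \<bullet> D k) - t\<^sup>2 * (k \<bullet> D h)\<bar> \<le> e * t\<^sup>2"
      using d1(2)[of t] d2(2)[of t] t by (smt (verit) field_sum_of_halves distrib_right)
    then have "\<bar>t\<^sup>2 * (h \<bullet> D k - k \<bullet> D h)\<bar> \<le> t\<^sup>2 * e"
      by (simp add: right_diff_distrib mult.commute)
    then have "t\<^sup>2 * \<bar>h \<bullet> D k - k \<bullet> D h\<bar> \<le> t\<^sup>2 * e"
      by (simp add: abs_mult)
    then show "\<bar>h \<bullet> D k - k \<bullet> D h\<bar> \<le> 0 + e"
      using t by simp
  qed
  then show ?thesis by simp
qed

section \<open>Hopf's boundary lemma at a flat boundary point\<close>

lemma half_disc_interior:
  fixes q n :: complex
  assumes "n \<noteq> 0"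
  shows "ball q r \<inter> {z. 0 < n \<bullet> (z - q)} \<subseteq> interior (cball q r \<inter> {z. 0 \<le> n \<bullet> (z - q)})"
proof (rule interior_maximal)
  have "open {z. 0 < n \<bullet> (z - q)}"
    by (intro open_Collect_less continuous_intros)
  then show "open (ball q r \<inter> {z. 0 < n \<bullet> (z - q)})"
    by auto
qed auto

text \<open>In a half disc on the flat side, \<open>w\<close> dominates a small multiple of a
  harmonic barrier that grows at least linearly along the normal.\<close>

lemma hopf_flat:
  fixes K :: "complex set"
  assumes K: "compact K" and w: "continuous_on K w"
    and W: "W holomorphic_on interior K" and wW: "\<And>z. z \<in> interior K \<Longrightarrow> w z = Re (W z)"
    and nn: "\<And>z. z \<in> K \<Longrightarrow> 0 \<le> w z" and pos: "\<And>z. z \<in> interior K \<Longrightarrow> 0 < w z"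
    and n: "norm n = 1" and r: "0 < r"
    and sub: "ball q r \<inter> {z. 0 < n \<bullet> (z - q)} \<subseteq> interior K"
  shows "\<exists>c>0. \<exists>d>0. \<forall>t\<in>{0<..<d}. c * t \<le> w (q + of_real t * n)"
proof -
  \<comment> \<open>The smaller radius puts the part of the arc away from the flat side inside the
    interior of \<open>K\<close>, where \<open>w\<close> is strictly positive.\<close>
  define r' where "r' = r / 2"
  have r': "0 < r'" "r' < r" using r by (auto simp: r'_def)
  have nn1: "n \<bullet> n = 1"
    using n by (simp add: dot_square_norm)
  define H where "H = cball q r' \<inter> {z. 0 \<le> n \<bullet> (z - q)}"
  have clh: "closed {z. 0 \<le> n \<bullet> (z - q)}"
    by (intro closed_Collect_le continuous_intros)
  have cvh: "convex {z. 0 \<le> n \<bullet> (z - q)}"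
    using convex_halfspace_ge[of "n \<bullet> q" n] by (simp add: inner_diff_right)
  have cH: "compact H" "convex H"
    unfolding H_def using clh cvh by (auto intro: compact_Int_closed convex_Int)
  define H0 where "H0 = ball q r' \<inter> {z. 0 < n \<bullet> (z - q)}"
  have H0: "H0 \<subseteq> interior H"
    unfolding H0_def H_def using n by (intro half_disc_interior) auto
  \<comment> \<open>\<open>sub\<close> speaks of the open half disc only; points of the flat side
    are limits along \<open>n\<close>, and \<open>K\<close> is closed.\<close>
  have HK: "H \<subseteq> K"
  proof
    fix z assume z: "z \<in> H"
    have lim: "((\<lambda>s. z + of_real s * n) \<longlongrightarrow> z) (at_right 0)"
      by (auto intro!: tendsto_eq_intros)
    have zb: "z \<in> ball q r"
      using z r' by (auto simp: H_def)
    show "z \<in> K"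
    proof (rule Lim_in_closed_set[OF compact_imp_closed[OF K] _ trivial_limit_at_right_real lim])
      have "\<forall>\<^sub>F s in at_right 0. z + of_real s * n \<in> ball q r"
        using topological_tendstoD[OF lim open_ball zb] .
      then show "\<forall>\<^sub>F s in at_right 0. z + of_real s * n \<in> K"
        using eventually_at_right_less[of "0::real"]
      proof eventually_elim
        case (elim s)
        have "n \<bullet> (z + of_real s * n - q) = n \<bullet> (z - q) + s"
          using nn1 by (simp add: inner_diff_right inner_add_right scaleR_conv_of_real[symmetric])
        then have "0 < n \<bullet> (z + of_real s * n - q)"
          using z elim by (simp add: H_def)
        with elim(1) sub show ?case
          using interior_subset by blast
      qed
    qed
  qed
  have HK0: "interior H \<subseteq> interior K"
    using HK by (rule interior_mono)
  define \<xi> where "\<xi> z = (z - q) * cnj n" for z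
  have \<xi>n: "norm (\<xi> z) = norm (z - q)" and \<xi>R: "Re (\<xi> z) = n \<bullet> (z - q)" for z
    by (simp_all add: \<xi>_def norm_mult n inner_complex_def mult.commute)
  \<comment> \<open>On the arc, with x the distance from the flat side, this \<open>k\<close> turns
    the bracket in \<open>b_eq\<close> into 4 x^2 / r'^2 - 2. It is negative for x at most r'/2 and
    never exceeds 2.\<close>
  define k where "k = 1 / r'\<^sup>2"
  \<comment> \<open>The harmonic barrier vanishes on the flat side; the cubic term makes it nonpositive on the parts of the
    half circle near the flat side, where \<open>w\<close> has no positive lower bound.\<close>
  define b where "b z = Re (\<xi> z + of_real k * \<xi> z ^ 3)" for z
  have b_eq: "b z = Re (\<xi> z) * (1 + k * (4 * (Re (\<xi> z))\<^sup>2 - 3 * (norm (z - q))\<^sup>2))" for z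
  proof -
    have "(norm (z - q))\<^sup>2 = (Re (\<xi> z))\<^sup>2 + (Im (\<xi> z))\<^sup>2"
      by (metis \<xi>n cmod_power2)
    then show ?thesis
      unfolding b_def by (simp add: power3_eq_cube power2_eq_square algebra_simps)
  qed
  define A where "A = sphere q r' \<inter> {z. r' / 2 \<le> n \<bullet> (z - q)}"
  have Ah: "closed {z. r' / 2 \<le> n \<bullet> (z - q)}"
    by (intro closed_Collect_le continuous_intros)
  then have cA: "compact A"
    unfolding A_def by (intro compact_Int_closed) auto
  have AK: "A \<subseteq> interior K"
    using sub r' by (auto simp: A_def subset_iff)
  obtain m where m: "0 < m" "\<And>z. z \<in> A \<Longrightarrow> m \<le> w z"
  proof (cases "A = {}")
    case True then show ?thesis using that[of 1] by auto
  next
    case False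
    have "continuous_on A w"
      using w AK interior_subset by (metis continuous_on_subset)
    then obtain z0 where "z0 \<in> A" "\<And>z. z \<in> A \<Longrightarrow> w z0 \<le> w z"
      using continuous_attains_inf[OF cA False] by metis
    with pos AK that[of "w z0"] show ?thesis by auto
  qed
  \<comment> \<open>On \<open>A\<close> the barrier is at most 2 r' and \<open>w\<close> is at least
    \<open>m\<close>.\<close>
  define c where "c = m / (2 * r')"
  have c: "0 < c" using m r' by (simp add: c_def)
  have contb: "continuous_on H b"
    unfolding b_def \<xi>_def by (intro continuous_intros)
  have dom: "0 \<le> w z - c * b z" if z: "z \<in> H" for z
  proof (rule harmonic_weak_min[OF cH _ _ _ _ _ z])
    show "interior H \<noteq> {}"
    proof -
      obtain t where "0 < t" "t < r'"
        using r'(1) dense by blast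
      then have "q + of_real t * n \<in> H0"
        using n nn1 by (auto simp: H0_def dist_norm norm_mult scaleR_conv_of_real[symmetric])
      with H0 show ?thesis by auto
    qed
    show "continuous_on H (\<lambda>z. w z - c * b z)"
      using w HK by (intro continuous_intros contb) (auto intro: continuous_on_subset)
    show "(\<lambda>z. W z - of_real c * (\<xi> z + of_real k * \<xi> z ^ 3)) holomorphic_on interior H"
      unfolding \<xi>_def using HK0 by (intro holomorphic_intros holomorphic_on_subset[OF W]) auto
    show "w z - c * b z = Re (W z - of_real c * (\<xi> z + of_real k * \<xi> z ^ 3))" if "z \<in> interior H" for z
      using that HK0 wW by (auto simp: b_def)
    show "0 \<le> w z - c * b z" if z: "z \<in> frontier H" for z
    proof -
      have zH: "z \<in> H" "z \<notin> interior H"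
        using z cH by (auto simp: frontier_def compact_imp_closed)
      then have "z \<notin> H0" using H0 by auto
      then consider "n \<bullet> (z - q) = 0" | "norm (z - q) = r'" "n \<bullet> (z - q) < r' / 2" | "z \<in> A"
        using zH(1) by (fastforce simp: H_def H0_def A_def dist_norm norm_minus_commute)
      then show ?thesis
      proof cases
        case 1
        then have "b z = 0" by (simp add: b_eq \<xi>R)
        then show ?thesis using nn zH HK by auto
      next
        case 2
        have p0: "0 \<le> n \<bullet> (z - q)" using zH by (simp add: H_def)
        have "(n \<bullet> (z - q))\<^sup>2 \<le> (r' / 2)\<^sup>2"
          using 2 p0 by (intro power_mono) auto
        then have "k * (4 * (n \<bullet> (z - q))\<^sup>2 - 3 * r'\<^sup>2) \<le> -2"
          using r' by (simp add: k_def field_simps power2_eq_square)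
        then have "b z \<le> 0"
          using p0 2 unfolding b_eq \<xi>R by (intro mult_nonneg_nonpos) auto
        then have "c * b z \<le> 0"
          using c by (simp add: mult_nonneg_nonpos)
        then show ?thesis using nn[of z] zH HK by auto
      next
        case 3
        have nz: "norm (z - q) = r'" and p0: "0 \<le> n \<bullet> (z - q)"
          using 3 r' by (auto simp: A_def dist_norm norm_minus_commute)
        have le: "n \<bullet> (z - q) \<le> r'"
          using norm_cauchy_schwarz[of n "z - q"] n nz by simp
        have "(n \<bullet> (z - q))\<^sup>2 \<le> r'\<^sup>2"
          using le p0 by (intro power_mono) auto
        then have "1 + k * (4 * (n \<bullet> (z - q))\<^sup>2 - 3 * r'\<^sup>2) \<le> 2"
          using r' by (simp add: k_def field_simps power2_eq_square)
        then have "b z \<le> (n \<bullet> (z - q)) * 2"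
          unfolding b_eq \<xi>R nz using p0 by (rule mult_left_mono)
        also have "\<dots> \<le> 2 * r'" using le by simp
        finally have "c * b z \<le> m"
          using c r' m by (simp add: c_def field_simps)
        then show ?thesis using m(2)[OF 3] by simp
      qed
    qed
  qed
  have "c * t \<le> w (q + of_real t * n)" if t: "t \<in> {0<..<r'}" for t
  proof -
    let ?z = "q + of_real t * n"
    have \<xi>t: "\<xi> ?z = of_real t"
      using n by (simp add: \<xi>_def complex_norm_square[symmetric] mult.assoc)
    have zH: "?z \<in> H"
      using t n nn1 by (auto simp: H_def dist_norm norm_mult scaleR_conv_of_real[symmetric])
    \<comment> \<open>Along the normal the barrier equals t + k t^3.\<close>
    have "t \<le> b ?z"
      using t by (simp add: b_def \<xi>t k_def flip: of_real_power of_real_mult)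
    then have "c * t \<le> c * b ?z" using c by simp
    then show ?thesis using dom[OF zH] by simp
  qed
  with c r' show ?thesis by blast
qed

text \<open>The other two sides are closed and miss \<open>q\<close>, so a small ball avoids them.
  The open half disc is connected, misses the whole frontier and contains a point of the segment
  from \<open>q\<close> to \<open>m\<close>, hence lies inside.\<close>

lemma half_disc_in_triangle:
  fixes a b m q n :: complex
  assumes nc: "\<not> collinear {a, b, m}" and q: "q \<in> open_segment a b"
    and n: "n \<bullet> (b - a) = 0" "0 < n \<bullet> (m - a)"
  shows "\<exists>r>0. ball q r \<inter> {z. 0 < n \<bullet> (z - q)} \<subseteq> interior (convex hull {a, b, m})"
proof -
  let ?K = "convex hull {a, b, m}"
  let ?S = "closed_segment b m \<union> closed_segment m a"
  have fr: "frontier ?K = closed_segment a b \<union> ?S"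
    using frontier_of_triangle[of a b m] by (auto simp: Un_assoc)
  obtain u where u: "0 < u" "u < 1" "q = (1 - u) *\<^sub>R a + u *\<^sub>R b" and ab: "a \<noteq> b"
    using q by (auto simp: in_segment)
  have nq: "n \<bullet> (z - q) = n \<bullet> (z - a)" for z
    using n by (simp add: u inner_diff_right inner_add_right algebra_simps)
  have line: "n \<bullet> (z - a) = 0" if "z \<in> closed_segment a b" for z
    using that n(1) unfolding in_segment
    by (elim conjE exE) (simp add: inner_diff_right inner_add_right left_diff_distrib)
  have qS: "q \<notin> ?S"
  proof
    assume "q \<in> ?S"
    then consider v where "0 \<le> v" "v \<le> 1" "q = (1 - v) *\<^sub>R b + v *\<^sub>R m" | v where "0 \<le> v" "v \<le> 1" "q = (1 - v) *\<^sub>R m + v *\<^sub>R a"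
      by (auto simp: in_segment)
    then show False
    proof cases
      case 1
      have "n \<bullet> (q - a) = (1 - v) * (n \<bullet> (b - a)) + v * (n \<bullet> (m - a))"
        by (simp add: 1(3) inner_diff_right inner_add_right algebra_simps)
      then have "v = 0" using n nq[of q] by simp
      with 1 q show False by (simp add: open_segment_def)
    next
      case 2
      have "n \<bullet> (q - a) = (1 - v) * (n \<bullet> (m - a))"
        by (simp add: 2(3) inner_diff_right inner_add_right algebra_simps)
      then have "v = 1" using n nq[of q] by simp
      with 2 q show False by (simp add: open_segment_def)
    qed
  qed
  have "open (- ?S)" by (intro open_Compl closed_Un closed_segment)
  with qS obtain r where r: "0 < r" "ball q r \<subseteq> - ?S"
    by (meson ComplI openE)
  define H where "H = ball q r \<inter> {z. 0 < n \<bullet> (z - q)}"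
  have "convex {z. 0 < n \<bullet> (z - q)}"
    using convex_halfspace_gt[of "n \<bullet> q" n] by (simp add: inner_diff_right)
  then have H: "connected H"
    unfolding H_def by (intro convex_connected convex_Int) auto
  have dis: "H \<inter> frontier ?K = {}"
    unfolding fr using r line by (auto simp: H_def nq)
  define s where "s = min 1 (r / (2 * norm (m - q)))"
  have mq: "m \<noteq> q" using n nq[of m] by auto
  have s: "0 < s" "s \<le> 1" using r mq by (auto simp: s_def)
  have "s * norm (m - q) \<le> r / (2 * norm (m - q)) * norm (m - q)"
    unfolding s_def by (intro mult_right_mono) auto
  then have sr: "s * norm (m - q) < r" using r mq by simp
  have qK: "q \<in> ?K"
    using u by (auto intro!: convexD[OF convex_convex_hull] simp: hull_inc)
  have "q + s *\<^sub>R (m - q) \<in> H"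
    using s sr n nq[of m] by (auto simp: H_def dist_norm)
  moreover have "q + s *\<^sub>R (m - q) \<in> ?K"
  proof -
    have "(1 - s) *\<^sub>R q + s *\<^sub>R m \<in> ?K"
      using s qK by (intro convexD) (auto simp: hull_inc)
    then show ?thesis by (simp add: algebra_simps)
  qed
  ultimately have "H \<subseteq> ?K"
    using connected_Int_frontier[OF H, of ?K] dis by blast
  then have "H \<subseteq> interior ?K"
    using dis by (auto simp: frontier_def closure_def)
  with r show ?thesis unfolding H_def by blast
qed

section \<open>Torsion functions of convex domains\<close>

text \<open>The imaginary part is the cross product of two edge vectors, twice the signed area; in
  this polynomial form nondegeneracy can be handled by algebra.\<close>

lemma collinear_iff_Im:
  fixes a b c :: complex
  shows "collinear {a, b, c} \<longleftrightarrow> Im (cnj (b - a) * (c - a)) = 0"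
proof -
  have "collinear {a, b, c} \<longleftrightarrow> collinear {0, b - a, c - a}"
    using collinear_3[of b a c] by (simp add: insert_commute)
  also have "\<dots> \<longleftrightarrow> Im ((c - a) / (b - a)) = 0"
    by (simp add: collinear_iff_Reals complex_is_Real_iff)
  also have "\<dots> \<longleftrightarrow> Im (cnj (b - a) * (c - a)) = 0"
    by (auto simp: Im_complex_div_eq_0 mult.commute)
  finally show ?thesis .
qed

lemma unit_normal_exists:
  fixes a b m :: complex
  assumes "\<not> collinear {a, b, m}"
  shows "\<exists>n. norm n = 1 \<and> n \<bullet> (b - a) = 0 \<and> 0 < n \<bullet> (m - a)"
proof -
  let ?I = "Im (cnj (b - a) * (m - a))"
  have I: "?I \<noteq> 0" using assms by (simp add: collinear_iff_Im)
  then have ba: "b - a \<noteq> 0" by auto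
  \<comment> \<open>The normal is the edge turned by a right angle and normalised; the sign of the
    area makes it point towards \<open>m\<close>.\<close>
  define c where "c = sgn ?I / norm (b - a)"
  define n where "n = of_real c * (\<i> * (b - a))"
  have n: "n \<bullet> x = c * Im (cnj (b - a) * x)" for x
    by (simp add: n_def inner_complex_def algebra_simps)
  have "norm n = 1"
    using I ba by (simp add: n_def c_def norm_mult norm_divide)
  moreover have "n \<bullet> (b - a) = 0"
    by (simp add: n algebra_simps)
  moreover have "0 < n \<bullet> (m - a)"
    using I ba unfolding n c_def by (simp add: sgn_if divide_neg_neg mult_neg_neg)
  ultimately show ?thesis by blast
qed

lemma norm_eq_abs_inner_normal:
  fixes n v x :: complex
  assumes "norm n = 1" "n \<bullet> v = 0" "v \<noteq> 0" "v \<bullet> x = 0"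
  shows "norm x = \<bar>n \<bullet> x\<bar>"
proof -
  \<comment> \<open>The Gram determinant of three vectors in the plane vanishes.\<close>
  have *: "(n \<bullet> v)\<^sup>2 * (norm x)\<^sup>2 + (norm n)\<^sup>2 * (v \<bullet> x)\<^sup>2 + (norm v)\<^sup>2 * (n \<bullet> x)\<^sup>2
     = (norm n)\<^sup>2 * (norm v)\<^sup>2 * (norm x)\<^sup>2 + 2 * (n \<bullet> v) * (v \<bullet> x) * (n \<bullet> x)"
    unfolding inner_complex_def cmod_power2 by algebra
  then have "(norm v)\<^sup>2 * (n \<bullet> x)\<^sup>2 = (norm v)\<^sup>2 * (norm x)\<^sup>2"
    using assms by simp
  then have "(norm x)\<^sup>2 = (n \<bullet> x)\<^sup>2"
    using assms by simp
  then show ?thesis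
    using power2_eq_iff_nonneg[of "norm x" "\<bar>n \<bullet> x\<bar>"] by simp
qed

text \<open>The equation is encoded by the potential \<open>F\<close>: Re F is harmonic and |z|^2 /
  4 has Laplacian 1. On the frontier \<open>g\<close> is known only through continuity.\<close>

locale torsion =
  fixes K :: "complex set" and U :: "complex \<Rightarrow> real" and F g :: "complex \<Rightarrow> complex"
  assumes K: "compact K" "convex K" and ne: "interior K \<noteq> {}"
    and contU: "continuous_on K U" and contg: "continuous_on K g"
    and F: "F holomorphic_on interior K"
    and U_eq: "\<And>z. z \<in> interior K \<Longrightarrow> U z = Re (F z) - (norm z)\<^sup>2 / 4"
    and zero: "\<And>z. z \<in> frontier K \<Longrightarrow> U z = 0"
    and der: "\<And>z. z \<in> interior K \<Longrightarrow> (U has_derivative (\<lambda>h. h \<bullet> g z)) (at z)"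
begin

lemma closedK: "closed K"
  using K compact_imp_closed by blast

lemma connected_interior: "connected (interior K)"
  using K by (simp add: convex_connected convex_interior)

lemma frontier_subset: "frontier K \<subseteq> K"
  using closedK by (rule frontier_subset_closed)

lemma frontier_nonempty: "frontier K \<noteq> {}"
  using ne K by (metis interior_subset subset_empty compact_imp_bounded frontier_eq_empty not_bounded_UNIV)

text \<open>Completing the square turns an interior minimum of the superharmonic function
  \<open>U\<close> at \<open>z0\<close> into one of the harmonic function \<open>U + \<bar>z - z0\<bar>\<^sup>2 / 4\<close>.\<close>

lemma no_interior_min:
  assumes z0: "z0 \<in> interior K" and min: "\<And>z. z \<in> interior K \<Longrightarrow> U z0 \<le> U z"
  shows False
proof -
  define W where "W z = F z - cnj z0 * z / 2" for z
  have W: "Re (W z) = U z + (norm (z - z0))\<^sup>2 / 4 - (norm z0)\<^sup>2 / 4" if "z \<in> interior K" for z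
    unfolding U_eq[OF that] W_def cmod_power2
    by (simp add: power2_eq_square field_simps)
  have const: "Re (W z) = Re (W z0)" if "z \<in> interior K" for z
  proof (rule harmonic_strong_min[OF _ open_interior connected_interior z0 _ that])
    show "W holomorphic_on interior K"
      unfolding W_def by (intro holomorphic_intros F) auto
    show "Re (W z0) \<le> Re (W z)" if "z \<in> interior K" for z
      unfolding W[OF z0] W[OF that] using min[OF that] by (simp add: add_increasing2)
  qed
  have "z = z0" if z: "z \<in> interior K" for z
  proof -
    have "(norm (z - z0))\<^sup>2 \<le> 0"
      using const[OF z] min[OF z] unfolding W[OF z0] W[OF z] diff_self norm_zero zero_power2 by linarith
    then show ?thesis by simp
  qed
  then have "interior K \<subseteq> {z0}" by auto
  then show False
    using open_interior ne by (metis not_open_singleton subset_singletonD)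
qed

lemma U_nonneg: "z \<in> K \<Longrightarrow> 0 \<le> U z"
proof -
  assume z: "z \<in> K"
  obtain z0 where z0: "z0 \<in> K" and min: "\<And>y. y \<in> K \<Longrightarrow> U z0 \<le> U y"
    using continuous_attains_inf[OF K(1) _ contU] z by auto
  have "z0 \<notin> interior K"
    using no_interior_min min interior_subset by (metis subsetD)
  then have "U z0 = 0"
    using z0 zero closedK by (simp add: frontier_def)
  with min z show ?thesis by force
qed

lemma U_pos: "z \<in> interior K \<Longrightarrow> 0 < U z"
  using no_interior_min[of z] U_nonneg interior_subset by (metis less_eq_real_def subsetD)

lemma der_within: "p \<in> K \<Longrightarrow> (U has_derivative (\<lambda>h. h \<bullet> g p)) (at p within K)"
  by (rule has_derivative_within_closure[OF K(2) closedK ne contU contg der])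

text \<open>At frontier points only one-sided quotients along segments that stay in \<open>K\<close>
  are available; through them signs and zeros of \<open>U\<close> near \<open>p\<close> give
  information on \<open>g p\<close>.\<close>

lemma directional_limit:
  assumes p: "p \<in> K" and d: "0 < d" and seg: "\<And>t. 0 < t \<Longrightarrow> t < d \<Longrightarrow> p + of_real t * v \<in> K"
  shows "((\<lambda>t. (U (p + of_real t * v) - U p) / t) \<longlongrightarrow> v \<bullet> g p) (at_right 0)"
proof -
  define S where "S = {0..<d}"
  have im: "(\<lambda>t. p + of_real t * v) ` S \<subseteq> K"
  proof clarsimp
    fix t assume "t \<in> S"
    then show "p + of_real t * v \<in> K"
      using p seg[of t] by (cases "t = 0") (auto simp: S_def)
  qed
  have "((\<lambda>t. U (p + of_real t * v)) has_derivative (\<lambda>t. (of_real t * v) \<bullet> g p)) (at 0 within S)"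
  proof (rule has_derivative_in_compose[where f = "\<lambda>t. p + of_real t * v" and g = U])
    show "((\<lambda>t. p + of_real t * v) has_derivative (\<lambda>t. of_real t * v)) (at 0 within S)"
      by (auto intro!: derivative_eq_intros)
    show "(U has_derivative (\<lambda>h. h \<bullet> g p)) (at (p + of_real 0 * v) within (\<lambda>t. p + of_real t * v) ` S)"
      using has_derivative_subset[OF der_within[OF p] im] by simp
  qed
  then have "((\<lambda>t. U (p + of_real t * v)) has_field_derivative (v \<bullet> g p)) (at 0 within S)"
    unfolding has_field_derivative_def by (rule has_derivative_eq_rhs) (auto simp flip: scaleR_conv_of_real)
  then have "((\<lambda>t. (U (p + of_real t * v) - U p) / t) \<longlongrightarrow> v \<bullet> g p) (at 0 within S)"
    unfolding has_field_derivative_iff by simp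
  moreover have "at 0 within S = at_right 0"
  proof -
    have "at 0 within S = at (0::real) within {0<..}"
      by (rule at_within_nhd[of _ "{-1<..<d}"]) (use d in \<open>auto simp: S_def\<close>)
    then show ?thesis .
  qed
  ultimately show ?thesis by simp
qed

lemma tangential_zero:
  assumes seg: "closed_segment a b \<subseteq> frontier K" and p: "p \<in> closed_segment a b" "p \<noteq> b"
  shows "(b - a) \<bullet> g p = 0"
proof -
  obtain u where u: "0 \<le> u" "u \<le> 1" "p = (1 - u) *\<^sub>R a + u *\<^sub>R b"
    using p by (auto simp: in_segment)
  with p have u1: "u < 1" by (cases "u = 1") auto
  have mem: "p + of_real t * (b - a) \<in> closed_segment a b" if "0 < t" "t < 1 - u" for t
    unfolding in_segment
    by (rule exI[of _ "u + t"]) (use that u in \<open>auto simp: scaleR_conv_of_real algebra_simps\<close>)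
  have "((\<lambda>t. (U (p + of_real t * (b - a)) - U p) / t) \<longlongrightarrow> (b - a) \<bullet> g p) (at_right 0)"
    using directional_limit[of p "1 - u" "b - a"] mem p(1) seg frontier_subset u1 by (simp add: subset_iff)
  moreover have "((\<lambda>t. (U (p + of_real t * (b - a)) - U p) / t) \<longlongrightarrow> 0) (at_right 0)"
  proof (rule tendsto_eventually)
    show "\<forall>\<^sub>F t in at_right 0. (U (p + of_real t * (b - a)) - U p) / t = 0"
      by (rule eventually_at_rightI[of 0 "1 - u"]) (use mem p(1) seg zero u1 in \<open>auto simp: subset_iff\<close>)
  qed
  ultimately show ?thesis
    using tendsto_unique trivial_limit_at_right_real by blast
qed

text \<open>For a fixed direction \<open>e\<close> the derivative of the quadratic term is Re (cnj e
  * z) / 2, so the directional derivative of \<open>U\<close> is the real part of a holomorphic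
  function.\<close>

lemma inner_gradient:
  assumes z: "z \<in> interior K"
  shows "e \<bullet> g z = Re (e * deriv F z - cnj e * z / 2)"
proof -
  have "(F has_field_derivative deriv F z) (at z)"
    using F z by (simp add: holomorphic_derivI)
  then have "((\<lambda>z. Re (F z) - (z \<bullet> z) / 4) has_derivative (\<lambda>h. Re (deriv F z * h) - (h \<bullet> z) / 2)) (at z)"
    unfolding has_field_derivative_def
    by (auto intro!: derivative_eq_intros simp: inner_commute)
  then have "(U has_derivative (\<lambda>h. Re (deriv F z * h) - (h \<bullet> z) / 2)) (at z)"
    by (rule has_derivative_transform_within_open[OF _ open_interior z]) (simp add: U_eq dot_square_norm)
  then have "(\<lambda>h. h \<bullet> g z) = (\<lambda>h. Re (deriv F z * h) - (h \<bullet> z) / 2)"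
    by (rule has_derivative_unique[OF der[OF z]])
  then have "e \<bullet> g z = Re (deriv F z * e) - (e \<bullet> z) / 2"
    by meson
  then show ?thesis
    by (simp add: inner_complex_def mult.commute)
qed

text \<open>Otherwise the gradient vanishes everywhere and \<open>U\<close> is constant, although it
  is zero on the frontier and positive inside.\<close>

lemma max_gradient_nonzero:
  assumes p: "p \<in> K" and max: "\<And>z. z \<in> K \<Longrightarrow> norm (g z) \<le> norm (g p)"
  shows "g p \<noteq> 0"
proof
  assume "g p = 0"
  then have g0: "g z = 0" if "z \<in> K" for z using max[OF that] by simp
  have "(U has_derivative (\<lambda>h. 0)) (at z within K)" if "z \<in> K" for z
    using der_within[OF that] g0[OF that] by simp
  then obtain c where "\<forall>z\<in>K. U z = c"
    using has_derivative_zero_constant[OF K(2)] by metis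
  moreover obtain z where "z \<in> frontier K" using frontier_nonempty by auto
  moreover obtain y where "y \<in> interior K" using ne by auto
  ultimately show False
    using U_pos[of y] zero[of z] frontier_subset interior_subset by (metis less_irrefl subsetD)
qed

text \<open>At an interior maximum \<open>p\<close> of \<open>\<bar>g\<bar>\<close> the harmonic function \<open>g p \<bullet> g\<close> is maximal as well, hence
  constant, but \<open>g\<close> vanishes where \<open>U\<close> is maximal.\<close>

lemma max_gradient_frontier:
  assumes p: "p \<in> K" and max: "\<And>z. z \<in> K \<Longrightarrow> norm (g z) \<le> norm (g p)"
  shows "p \<in> frontier K"
proof (rule ccontr)
  assume "p \<notin> frontier K"
  then have pi: "p \<in> interior K" using p closedK by (simp add: frontier_def)
  define e where "e = g p"
  define W where "W z = - (e * deriv F z - cnj e * z / 2)" for z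
  have W: "Re (W z) = - (e \<bullet> g z)" if "z \<in> interior K" for z
    unfolding inner_gradient[OF that] W_def by simp
  have const: "Re (W z) = Re (W p)" if "z \<in> interior K" for z
  proof (rule harmonic_strong_min[OF _ open_interior connected_interior pi _ that])
    show "W holomorphic_on interior K"
      unfolding W_def by (intro holomorphic_intros F open_interior) auto
    show "Re (W p) \<le> Re (W z)" if z: "z \<in> interior K" for z
    proof -
      have "e \<bullet> g z \<le> norm e * norm (g z)" by (rule norm_cauchy_schwarz)
      also have "\<dots> \<le> norm e * norm e"
        using max z interior_subset by (auto simp: e_def intro!: mult_left_mono)
      also have "\<dots> = e \<bullet> g p" by (simp add: e_def dot_square_norm power2_eq_square)
      finally show ?thesis unfolding W[OF pi] W[OF z] by simp
    qed
  qed
  obtain z1 where z1: "z1 \<in> K" and m: "\<And>z. z \<in> K \<Longrightarrow> U z \<le> U z1"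
    using continuous_attains_sup[OF K(1) _ contU] p by auto
  have "0 < U z1" using U_pos[OF pi] m[OF p] by simp
  then have i1: "z1 \<in> interior K"
    using zero[of z1] z1 closedK by (auto simp: frontier_def)
  have "(\<lambda>h. h \<bullet> g z1) = (\<lambda>h. 0)"
    by (rule differential_zero_maxmin[OF i1 open_interior der[OF i1]])
       (use m interior_subset in blast)
  then have "e \<bullet> g z1 = 0" by meson
  then have "e \<bullet> g p = 0" using const[OF i1] W i1 pi by simp
  then have "g p = 0" by (simp add: e_def)
  with max_gradient_nonzero[OF p max] show False by simp
qed

end

section \<open>Reflections\<close>

text \<open>The reflection across the line through \<open>L\<close> and \<open>M\<close>:
  conjugation about \<open>L\<close>, followed by multiplication by the square of the unit direction
  of \<open>M - L\<close>. For \<open>M = L\<close> division by zero makes it constantly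
  \<open>L\<close>, hence the side conditions below.\<close>

definition reflect :: "complex \<Rightarrow> complex \<Rightarrow> complex \<Rightarrow> complex"
  where "reflect L M z = L + (M - L) / cnj (M - L) * cnj (z - L)"

lemma reflect_simps [simp]: "reflect L M L = L" "M \<noteq> L \<Longrightarrow> reflect L M M = M"
  by (simp_all add: reflect_def)

lemma reflect_reflect [simp]: "M \<noteq> L \<Longrightarrow> reflect L M (reflect L M z) = z"
  by (simp add: reflect_def)

lemma reflect_add: "reflect L M (z + v) = reflect L M z + (M - L) / cnj (M - L) * cnj v"
  by (simp add: reflect_def algebra_simps add_divide_distrib diff_divide_distrib)

lemma reflect_affine:
  "reflect L M ((1 - u) *\<^sub>R x + u *\<^sub>R y) = (1 - u) *\<^sub>R reflect L M x + u *\<^sub>R reflect L M y"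
proof -
  define c where "c = (M - L) / cnj (M - L)"
  show ?thesis
    unfolding reflect_def c_def[symmetric] by (simp add: scaleR_conv_of_real algebra_simps)
qed

lemma reflect_closed_segment:
  "z \<in> closed_segment x y \<Longrightarrow> reflect L M z \<in> closed_segment (reflect L M x) (reflect L M y)"
  by (auto simp: in_segment reflect_affine)

lemma reflect_open_segment:
  assumes "M \<noteq> L" "z \<in> open_segment x y"
  shows "reflect L M z \<in> open_segment (reflect L M x) (reflect L M y)"
proof -
  have "reflect L M x \<noteq> reflect L M y"
    using assms by (metis reflect_reflect in_segment(2))
  then show ?thesis
    using assms by (auto simp: in_segment reflect_affine)
qed

lemma convex_reflect_vimage: "convex K \<Longrightarrow> convex {z. reflect L M z \<in> K}"
  by (auto simp: convex_alt reflect_affine)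

context torsion
begin

text \<open>The cap has vertices \<open>L\<close>, \<open>V\<close>, \<open>M\<close> and mirror
  line \<open>LM\<close>; its image is the triangle \<open>T\<close>. The difference
  \<open>w\<close> vanishes on the mirror line, and on the images of the two other cap sides it
  equals \<open>U\<close>, which is positive at \<open>y\<close>. Hopf's lemma at the mirror image
  of \<open>p\<close> compares the normal derivatives. Leaving \<open>L\<close> free covers both
  uses: a vertex for the bisector, a point of the side for the perpendicular.\<close>

lemma reflection_gradient_less:
  assumes nc: "\<not> collinear {L, V', M}" and V': "V' = reflect L M V"
    and LVM: "L \<in> K" "V \<in> K" "M \<in> K" "V' \<in> K"
    and seg: "closed_segment L V \<subseteq> frontier K" "closed_segment V M \<subseteq> frontier K" "closed_segment L V' \<subseteq> frontier K"
    and y: "y \<in> closed_segment V' M" "y \<in> interior K"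
    and p: "p \<in> open_segment L V"
  shows "\<exists>q\<in>K. norm (g p) < norm (g q)"
proof -
  let ?\<sigma> = "reflect L M"
  define \<omega> where "\<omega> = (M - L) / cnj (M - L)"
  define T where "T = convex hull {L, V', M}"
  have MneL: "M \<noteq> L"
    using nc by (auto simp: insert_commute)
  have \<omega>: "norm \<omega> = 1" "\<omega> * cnj \<omega> = 1"
    using MneL by (auto simp: \<omega>_def norm_divide simp flip: complex_cnj_diff)
  have V: "?\<sigma> V' = V" using MneL by (simp add: V')
  have T: "compact T" "convex T"
    unfolding T_def by (auto intro: compact_convex_hull finite_imp_compact)
  have TK: "T \<subseteq> K"
    unfolding T_def using LVM K by (intro hull_minimal) auto
  have \<sigma>K: "?\<sigma> z \<in> K" if "z \<in> T" for z
  proof -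
    have "T \<subseteq> {z. ?\<sigma> z \<in> K}"
      unfolding T_def using LVM K V MneL by (intro hull_minimal convex_reflect_vimage) auto
    with that show ?thesis by auto
  qed
  have cont\<sigma>: "continuous_on A ?\<sigma>" for A
    unfolding reflect_def by (intro continuous_intros) (use MneL in auto)
  have \<sigma>int: "?\<sigma> z \<in> interior K" if z: "z \<in> interior T" for z
  proof -
    have "open (?\<sigma> -` interior T)"
      using cont\<sigma> open_vimage open_interior by blast
    moreover have "?\<sigma> -` interior T \<subseteq> K"
      using \<sigma>K interior_subset MneL by (metis reflect_reflect subsetD subsetI vimageE)
    ultimately have "?\<sigma> -` interior T \<subseteq> interior K"
      by (rule interior_maximal[rotated])
    then show ?thesis using z MneL by auto
  qed
  have intTK: "interior T \<subseteq> interior K" using TK by (rule interior_mono)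
  define w where "w z = U z - U (?\<sigma> z)" for z
  \<comment> \<open>Conjugating the antiholomorphic \<open>F \<circ> reflect L M\<close> keeps its
    real part and makes it holomorphic. The last term is the affine function left over from the two
    quadratic terms.\<close>
  define W where "W z = F z - cnj (F (?\<sigma> z)) + (L * cnj \<omega> - cnj L) * (z - L) / 2" for z
  have contw: "continuous_on T w"
    unfolding w_def using TK \<sigma>K
    by (intro continuous_intros continuous_on_subset[OF contU] continuous_on_compose2[OF contU cont\<sigma>]) auto
  have W: "W holomorphic_on interior T"
  proof -
    \<comment> \<open>The conjugate of the reflection is an affine holomorphic map, so the reflected
      potential factors through it and \<open>cnj \<circ> F \<circ> cnj\<close>.\<close>
    define \<tau> where "\<tau> z = cnj L + cnj \<omega> * (z - L)" for z
    have \<tau>: "?\<sigma> z = cnj (\<tau> z)" for z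
      by (simp add: \<tau>_def reflect_def \<omega>_def)
    have "open (cnj ` interior K)"
      unfolding image_cnj_conv_vimage_cnj by (intro open_vimage continuous_intros) auto
    moreover have "F holomorphic_on cnj ` cnj ` interior K"
      using F by (simp add: image_image)
    ultimately have "(cnj \<circ> F \<circ> cnj) holomorphic_on (cnj ` interior K)"
      by (intro holomorphic_on_compose_cnj_cnj)
    moreover have "\<tau> holomorphic_on interior T"
      unfolding \<tau>_def by (intro holomorphic_intros)
    moreover have "\<tau> ` interior T \<subseteq> cnj ` interior K"
    proof clarify
      fix z assume "z \<in> interior T"
      from \<sigma>int[OF this] show "\<tau> z \<in> cnj ` interior K"
        unfolding \<tau> by (metis complex_cnj_cnj image_eqI)
    qed
    ultimately have "((cnj \<circ> F \<circ> cnj) \<circ> \<tau>) holomorphic_on interior T"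
      using holomorphic_on_compose_gen by blast
    then have "(\<lambda>z. cnj (F (?\<sigma> z))) holomorphic_on interior T"
      by (simp add: \<tau> o_def)
    then show ?thesis
      unfolding W_def using intTK by (intro holomorphic_intros holomorphic_on_subset[OF F]) auto
  qed
  have wW: "w z = Re (W z)" if z: "z \<in> interior T" for z
  proof -
    let ?v = "z - L"
    have nsq: "(norm x)\<^sup>2 = Re (x * cnj x)" for x
      by (simp flip: complex_norm_square)
    have "?\<sigma> z = L + \<omega> * cnj ?v"
      by (simp add: reflect_def \<omega>_def)
    then have "(norm (?\<sigma> z))\<^sup>2 = Re ((L + \<omega> * cnj ?v) * cnj (L + \<omega> * cnj ?v))"
      by (simp only: nsq)
    also have "(L + \<omega> * cnj ?v) * cnj (L + \<omega> * cnj ?v)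
      = L * cnj L + (\<omega> * cnj \<omega>) * (?v * cnj ?v) + L * cnj \<omega> * ?v + cnj (L * cnj \<omega> * ?v)"
      by (simp add: algebra_simps)
    finally have s: "(norm (?\<sigma> z))\<^sup>2 = (norm L)\<^sup>2 + (norm ?v)\<^sup>2 + 2 * Re (L * cnj \<omega> * ?v)"
      unfolding \<omega> mult_1 plus_complex.sel cnj.sel nsq by linarith
    have "(norm z)\<^sup>2 = Re ((L + ?v) * cnj (L + ?v))"
      by (simp only: nsq add_diff_eq add_diff_cancel_left')
    also have "(L + ?v) * cnj (L + ?v) = L * cnj L + ?v * cnj ?v + cnj L * ?v + cnj (cnj L * ?v)"
      by (simp add: algebra_simps)
    finally have "(norm z)\<^sup>2 = (norm L)\<^sup>2 + (norm ?v)\<^sup>2 + 2 * Re (cnj L * ?v)"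
      unfolding plus_complex.sel cnj.sel nsq by linarith
    moreover have "w z = Re (F z) - (norm z)\<^sup>2 / 4 - (Re (F (?\<sigma> z)) - (norm (?\<sigma> z))\<^sup>2 / 4)"
      unfolding w_def using U_eq[of z] U_eq[OF \<sigma>int[OF z]] z intTK by auto
    moreover have "Re (W z) = Re (F z) - Re (F (?\<sigma> z)) + (Re (L * cnj \<omega> * ?v) - Re (cnj L * ?v)) / 2"
      unfolding W_def by (simp add: left_diff_distrib del: times_complex.simps)
    ultimately show ?thesis using s by (simp add: field_simps)
  qed
  have fr: "frontier T = closed_segment L V' \<union> closed_segment V' M \<union> closed_segment M L"
    unfolding T_def using frontier_of_triangle[of L V' M] by simp
  have frT: "z \<in> T" if "z \<in> frontier T" for z
    using that T by (metis compact_imp_closed frontier_subset_closed subsetD)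
  have w_V'M: "w z = U z" if "z \<in> closed_segment V' M" for z
    using reflect_closed_segment[OF that, of L M] MneL V zero[of "?\<sigma> z"] seg(2)
    by (auto simp: w_def)
  have frw: "0 \<le> w z" if z: "z \<in> frontier T" for z
    using z unfolding fr
  proof (elim UnE)
    assume z: "z \<in> closed_segment L V'"
    have "?\<sigma> z \<in> closed_segment L V"
      using reflect_closed_segment[OF z, of L M] V by simp
    with z seg zero show ?thesis by (auto simp: w_def subset_iff)
  next
    assume "z \<in> closed_segment V' M"
    with w_V'M U_nonneg frT[OF that] TK show ?thesis by auto
  next
    assume z: "z \<in> closed_segment M L"
    then obtain u where "z = (1 - u) *\<^sub>R M + u *\<^sub>R L" by (auto simp: in_segment)
    then have "?\<sigma> z = z" using MneL by (simp add: reflect_affine)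
    then show ?thesis by (simp add: w_def)
  qed
  have yT: "y \<in> T" "0 < w y"
    using y w_V'M[of y] U_pos frT[of y] unfolding fr by auto
  have pos: "0 < w z" if "z \<in> interior T" for z
    using harmonic_pos[OF T contw W wW frw yT that] .
  define q where "q = ?\<sigma> p"
  have q: "q \<in> open_segment L V'"
    using reflect_open_segment[OF MneL p] by (simp add: q_def V')
  obtain n where n: "norm n = 1" "n \<bullet> (V' - L) = 0" "0 < n \<bullet> (M - L)"
    using unit_normal_exists[OF nc] by blast
  obtain r where r: "0 < r" "ball q r \<inter> {z. 0 < n \<bullet> (z - q)} \<subseteq> interior T"
    unfolding T_def using half_disc_in_triangle[OF nc q n(2,3)] by blast
  have nn1: "n \<bullet> n = 1" using n by (simp add: dot_square_norm)
  have qint: "q + of_real t * n \<in> interior T" if t: "0 < t" "t < r" for t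
  proof -
    have "q + of_real t * n \<in> ball q r \<inter> {z. 0 < n \<bullet> (z - q)}"
      using t n nn1 by (auto simp: dist_norm norm_mult simp flip: scaleR_conv_of_real)
    with r show ?thesis by blast
  qed
  then have qt: "q + of_real t * n \<in> T" if "0 < t" "t < r" for t
    using that interior_subset by blast
  obtain t0 where "0 < t0" "t0 < r" using r(1) dense by blast
  with qint have neT: "interior T \<noteq> {}" by blast
  have nn: "0 \<le> w z" if "z \<in> T" for z
    using harmonic_weak_min[OF T neT contw W wW frw that] .
  obtain c d where c: "0 < c" and d: "0 < d" and cd: "\<And>t. t \<in> {0<..<d} \<Longrightarrow> c * t \<le> w (q + of_real t * n)"
    using hopf_flat[OF T(1) contw W wW nn pos n(1) r] by blast
  \<comment> \<open>The mirror image of the normal direction: the reflection carries the normal ray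
    at \<open>q\<close> to the ray from \<open>p\<close> along \<open>n'\<close>.\<close>
  define n' where "n' = \<omega> * cnj n"
  have \<sigma>qt: "?\<sigma> (q + of_real t * n) = p + of_real t * n'" for t
    using MneL by (simp add: reflect_add q_def n'_def \<omega>_def)
  have pK: "p \<in> K" "U p = 0" and qK: "q \<in> K" "U q = 0"
    using p q seg zero frontier_subset segment_open_subset_closed by (blast+)
  have lim_q: "((\<lambda>t. (U (q + of_real t * n) - U q) / t) \<longlongrightarrow> n \<bullet> g q) (at_right 0)"
    using qt TK by (intro directional_limit[OF qK(1) r(1)]) auto
  have lim_p: "((\<lambda>t. (U (p + of_real t * n') - U p) / t) \<longlongrightarrow> n' \<bullet> g p) (at_right 0)"
    using qt \<sigma>K \<sigma>qt by (intro directional_limit[OF pK(1) r(1)]) metis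
  have "c \<le> n \<bullet> g q - n' \<bullet> g p"
  proof (rule tendsto_lowerbound[OF tendsto_diff[OF lim_q lim_p] _ trivial_limit_at_right_real])
    show "\<forall>\<^sub>F t in at_right 0. c \<le> (U (q + of_real t * n) - U q) / t - (U (p + of_real t * n') - U p) / t"
    proof (rule eventually_at_rightI[of 0 d])
      fix t :: real assume t: "t \<in> {0<..<d}"
      then show "c \<le> (U (q + of_real t * n) - U q) / t - (U (p + of_real t * n') - U p) / t"
        using cd[OF t] \<sigma>qt[of t] qK pK by (simp add: w_def field_simps)
    qed (rule d)
  qed
  moreover have "0 \<le> n' \<bullet> g p"
  proof (rule tendsto_lowerbound[OF lim_p _ trivial_limit_at_right_real])
    show "\<forall>\<^sub>F t in at_right 0. 0 \<le> (U (p + of_real t * n') - U p) / t"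
    proof (rule eventually_at_rightI[of 0 r])
      fix t :: real assume t: "t \<in> {0<..<r}"
      then have "0 \<le> U (p + of_real t * n')"
        using U_nonneg \<sigma>K qt \<sigma>qt by (metis greaterThanLessThan_iff)
      then show "0 \<le> (U (p + of_real t * n') - U p) / t"
        using t pK by simp
    qed (rule r)
  qed
  moreover have "norm (g p) = \<bar>n' \<bullet> g p\<bar>"
  proof (rule norm_eq_abs_inner_normal)
    show "norm n' = 1" using \<omega> n by (simp add: n'_def norm_mult)
    have VL: "V - L = \<omega> * cnj (V' - L)"
      using V by (metis \<omega>_def add_diff_cancel_left' reflect_def)
    have "n' \<bullet> (V - L) = Re (\<omega> * cnj \<omega> * cnj (cnj n * (V' - L)))"
      unfolding VL n'_def by (simp add: inner_complex_def algebra_simps)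
    then show "n' \<bullet> (V - L) = 0"
      using n(2) \<omega> by (simp add: inner_complex_def algebra_simps)
    show "V - L \<noteq> 0" using p by auto
    show "(V - L) \<bullet> g p = 0"
      using tangential_zero[OF seg(1)] p by (auto simp: open_segment_def)
  qed
  moreover have "n \<bullet> g q \<le> norm (g q)"
    using norm_cauchy_schwarz[of n "g q"] n by simp
  ultimately have "norm (g p) < norm (g q)"
    using c by linarith
  with qK show ?thesis by blast
qed

end

section \<open>Fail points of triangles\<close>

text \<open>Clearing the denominator reduces the identification of a mirror image to a polynomial
  identity.\<close>

lemma reflect_eqI:
  assumes "M \<noteq> L" "(V' - L) * cnj (M - L) = (M - L) * cnj (V - L)"
  shows "V' = reflect L M V"
proof -
  have "V' - L = (M - L) / cnj (M - L) * cnj (V - L)"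
    using assms by (simp add: eq_divide_eq flip: complex_cnj_diff)
  then show ?thesis by (simp add: reflect_def algebra_simps)
qed

context torsion
begin

lemma triangle_sides:
  assumes "K = convex hull {P, Q, R}"
  shows "closed_segment P Q \<subseteq> frontier K" "closed_segment P R \<subseteq> frontier K" "closed_segment Q R \<subseteq> frontier K"
  unfolding assms using frontier_of_triangle[of P Q R] by (auto simp: closed_segment_commute)

text \<open>The cap with vertices \<open>P\<close>, \<open>L\<close>, \<open>M\<close>, cut off by a perpendicular \<open>LM\<close> to the side \<open>PQ\<close>
  before both the midpoint and the foot of the altitude, is reflected across \<open>LM\<close>.\<close>

lemma gradient_less_near_vertex:
  assumes tri: "K = convex hull {P, Q, R}" and nc: "\<not> collinear {P, Q, R}"
    and s: "0 < s" "s < 1 / 2" "s < \<eta>"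
    and foot: "(R - P - of_real \<eta> * (Q - P)) \<bullet> (Q - P) = 0"
  shows "\<exists>q\<in>K. norm (g (P + of_real s * (Q - P))) < norm (g q)"
proof -
  \<comment> \<open>The cut at \<open>l\<close> lies beyond the point at \<open>s\<close>. Below 1/2
    the image of \<open>P\<close>, at parameter 2 l, stays before \<open>Q\<close>; below
    \<open>\<eta>\<close> the perpendicular meets \<open>PR\<close> before \<open>R\<close>.\<close>
  obtain l where l: "s < l" "l < min (1/2) \<eta>" using s dense[of s "min (1/2) \<eta>"] by auto
  \<comment> \<open>By similar triangles the perpendicular at parameter \<open>l\<close> meets
    \<open>PR\<close> at parameter \<open>l / \<eta>\<close>; \<open>X\<close> is the altitude
    vector from the foot to \<open>R\<close>.\<close>
  define k where "k = l / \<eta>"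
  have k: "0 < k" "k < 1" "k * \<eta> = l" using l s by (auto simp: k_def)
  define D X where "D = Q - P" and "X = R - P - of_real \<eta> * D"
  define L V' M where "L = P + of_real l * D" and "V' = P + of_real (2 * l) * D" and "M = P + of_real k * (R - P)"
  have I: "Im (cnj D * (R - P)) \<noteq> 0"
    using nc by (simp add: collinear_iff_Im D_def)
  have M_sub_L: "M - L = of_real k * X"
    using k by (simp add: M_def L_def X_def algebra_simps flip: of_real_mult)
  have "Im (cnj D * X) = Im (cnj D * (R - P))"
    by (simp add: X_def algebra_simps)
  then have X0: "X \<noteq> 0" using I by auto
  then have MneL: "M \<noteq> L" using M_sub_L k by auto
  \<comment> \<open>Orthogonality of the altitude and the side, written as a complex equation: D *
    cnj X is purely imaginary.\<close>
  have DX: "D * cnj X = - (X * cnj D)"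
    using foot by (simp add: complex_eq_iff inner_complex_def X_def D_def algebra_simps)
  have V'L: "V' - L = of_real l * D" and PL: "P - L = - (of_real l * D)"
    by (simp_all add: V'_def L_def algebra_simps)
  have refl: "V' = reflect L M P"
  proof (rule reflect_eqI[OF MneL])
    have "(V' - L) * cnj (M - L) = of_real l * of_real k * (D * cnj X)"
      unfolding V'L M_sub_L by simp
    also have "\<dots> = (M - L) * cnj (P - L)"
      unfolding DX PL M_sub_L by simp
    finally show "(V' - L) * cnj (M - L) = (M - L) * cnj (P - L)" .
  qed
  have nc': "\<not> collinear {L, V', M}"
  proof -
    have "Im (cnj (V' - L) * (M - L)) = l * k * Im (cnj D * X)"
      unfolding V'L M_sub_L by (simp add: algebra_simps)
    then show ?thesis
      using k l s I \<open>Im (cnj D * X) = Im (cnj D * (R - P))\<close> by (simp add: collinear_iff_Im)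
  qed
  have mem: "L \<in> closed_segment P Q" "V' \<in> closed_segment P Q" "M \<in> closed_segment P R"
    unfolding in_segment
    by (rule exI[of _ l] exI[of _ "2 * l"] exI[of _ k],
        use l k s in \<open>simp add: L_def V'_def M_def D_def scaleR_conv_of_real algebra_simps\<close>)+
  then have seg: "closed_segment L P \<subseteq> frontier K" "closed_segment P M \<subseteq> frontier K" "closed_segment L V' \<subseteq> frontier K"
    using triangle_sides[OF tri] by (meson ends_in_segment order_trans subset_closed_segment)+
  \<comment> \<open>The midpoint of \<open>V'M\<close> has the positive barycentric weights 1 - l -
    k/2, l and k/2.\<close>
  define y where "y = (1/2) *\<^sub>R (V' + M)"
  have "y \<in> interior K"
  proof -
    have "k / 2 + l < 1" "0 < l" using l k s by auto
    then have "0 < 1 - l - k / 2" "0 < l" "0 < k / 2" "1 - l - k / 2 + l + k / 2 = 1"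
      using k by auto
    moreover have "y = (1 - l - k / 2) *\<^sub>R P + l *\<^sub>R Q + (k / 2) *\<^sub>R R"
      by (simp add: y_def V'_def M_def D_def scaleR_conv_of_real field_simps)
    ultimately show ?thesis
      unfolding tri interior_convex_hull_3_minimal[OF nc DIM_complex] by blast
  qed
  moreover have "y \<in> closed_segment V' M"
    unfolding in_segment y_def by (rule exI[of _ "1/2"]) (simp add: scaleR_right_distrib)
  moreover have "P + of_real s * (Q - P) \<in> open_segment L P"
    unfolding in_segment
  proof (intro conjI exI[of _ "1 - s / l"])
    show "L \<noteq> P" using PL l s I by auto
  qed (use l s in \<open>simp_all add: L_def D_def scaleR_conv_of_real field_simps\<close>)
  ultimately show ?thesis
    by (intro reflection_gradient_less[OF nc' refl]) (use seg frontier_subset in auto)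
qed

text \<open>The bisector at \<open>P\<close> sends \<open>Q\<close> to the point of the ray
  \<open>PR\<close> at the same distance from \<open>P\<close>. As \<open>PQ\<close> is shorter than
  \<open>PR\<close>, this point lies before \<open>R\<close>, so the reflected cap stays in the
  triangle.\<close>

lemma gradient_less_short_side:
  assumes tri: "K = convex hull {P, Q, R}" and nc: "\<not> collinear {P, Q, R}"
    and less: "dist P Q < dist P R" and p: "p \<in> open_segment P Q"
  shows "\<exists>q\<in>K. norm (g p) < norm (g q)"
proof -
  define d e where "d = Q - P" and "e = R - P"
  define a b where "a = norm d" and "b = norm e"
  have I: "Im (cnj d * e) \<noteq> 0"
    using nc by (simp add: collinear_iff_Im d_def e_def)
  then have ab: "0 < a" "a < b"
    using less by (auto simp: a_def b_def d_def e_def dist_norm norm_minus_commute)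
  \<comment> \<open>\<open>k\<close> places the image of \<open>Q\<close> on \<open>PR\<close>;
    \<open>m\<close> comes from the angle bisector theorem, which divides \<open>QR\<close> in the
    ratio of the adjacent sides.\<close>
  define k m where "k = a / b" and "m = a / (a + b)"
  have k: "0 < k" "k < 1" and m: "0 < m" "m < 1" using ab by (auto simp: k_def m_def)
  \<comment> \<open>Reciprocals get names of their own, so the identities below are polynomial and
    fall to \<open>algebra\<close>. Here \<open>i\<close> is the real number 1 / (a + b), not the
    imaginary unit.\<close>
  define A B i j :: complex where "A = of_real a" and "B = of_real b" and "i = of_real (1 / (a + b))" and "j = of_real (1 / b)"
  have Bj: "B * j = 1" and ABi: "(A + B) * i = 1"
    using ab by (simp_all add: A_def B_def i_def j_def flip: of_real_add of_real_mult)
  have kj: "of_real k = A * j" and mi: "of_real m = A * i"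
    by (simp_all add: k_def m_def A_def i_def j_def)
  have cn: "cnj A = A" "cnj B = B" "cnj i = i" "cnj j = j"
    by (simp_all add: A_def B_def i_def j_def)
  \<comment> \<open>\<open>M\<close> is the foot of the bisector of the angle at \<open>P\<close>.\<close>
  define V' M where "V' = P + of_real k * e" and "M = Q + of_real m * (R - Q)"
  have MP: "M - P = i * (B * d + A * e)"
    using ABi unfolding M_def mi d_def e_def by algebra
  have V'P: "V' - P = A * j * e" by (simp add: V'_def kj)
  have dd: "d * cnj d = A\<^sup>2" and ee: "e * cnj e = B\<^sup>2"
    by (simp_all add: a_def b_def A_def B_def complex_norm_square flip: of_real_power)
  have nc': "\<not> collinear {P, V', M}"
  proof -
    have "cnj (V' - P) * (M - P) = A * i * (cnj e * d) + A\<^sup>2 * i * B"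
      unfolding MP V'P complex_cnj_mult cn using Bj ee by algebra
    then have "Im (cnj (V' - P) * (M - P)) = a / (a + b) * Im (cnj e * d)"
      by (simp add: A_def B_def i_def flip: of_real_power)
    moreover have "Im (cnj e * d) = - Im (cnj d * e)" by simp
    ultimately show ?thesis using ab I by (auto simp: collinear_iff_Im mult.commute)
  qed
  then have MneP: "M \<noteq> P" by (auto simp: insert_commute)
  have refl: "V' = reflect P M Q"
  proof (rule reflect_eqI[OF MneP])
    show "(V' - P) * cnj (M - P) = (M - P) * cnj (Q - P)"
      unfolding MP V'P d_def[symmetric] complex_cnj_mult complex_cnj_add cn using Bj dd ee by algebra
  qed
  have mem: "V' \<in> closed_segment P R" "M \<in> closed_segment Q R"
    unfolding in_segment
    by (rule exI[of _ k] exI[of _ m],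
        use k m in \<open>simp add: V'_def M_def e_def scaleR_conv_of_real algebra_simps\<close>)+
  then have seg: "closed_segment P Q \<subseteq> frontier K" "closed_segment Q M \<subseteq> frontier K" "closed_segment P V' \<subseteq> frontier K"
    using triangle_sides[OF tri] by (meson ends_in_segment order_trans subset_closed_segment)+
  define y where "y = (1/2) *\<^sub>R (V' + M)"
  have "y \<in> interior K"
  proof -
    have "y = ((1 - k) / 2) *\<^sub>R P + ((1 - m) / 2) *\<^sub>R Q + ((k + m) / 2) *\<^sub>R R"
      by (simp add: y_def V'_def M_def e_def scaleR_conv_of_real field_simps)
    moreover have "(1 - k) / 2 + (1 - m) / 2 + (k + m) / 2 = 1"
      by (simp add: field_simps)
    moreover have "0 < (1 - k) / 2" "0 < (1 - m) / 2" "0 < (k + m) / 2"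
      using k m by auto
    ultimately show ?thesis
      unfolding tri interior_convex_hull_3_minimal[OF nc DIM_complex] by blast
  qed
  moreover have "y \<in> closed_segment V' M"
    unfolding in_segment y_def by (rule exI[of _ "1/2"]) (simp add: scaleR_right_distrib)
  ultimately show ?thesis
    by (intro reflection_gradient_less[OF nc' refl _ _ _ _ _ _ _ _ _ p]) (use seg frontier_subset in auto)
qed

text \<open>\<open>U\<close> vanishes along two independent directions at a vertex, so its gradient
  is zero there, while the maximal gradient is not.\<close>

lemma max_gradient_not_vertex:
  assumes tri: "K = convex hull {P, Q, R}" and nc: "\<not> collinear {P, Q, R}"
    and max: "\<And>z. z \<in> K \<Longrightarrow> norm (g z) \<le> norm (g p)"
  shows "p \<noteq> P"
proof
  assume p: "p = P"
  have PQ: "P \<noteq> Q" "P \<noteq> R" using nc by (auto simp: collinear_iff_Im)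
  have "(Q - P) \<bullet> g P = 0" "(R - P) \<bullet> g P = 0"
    using triangle_sides[OF tri] PQ by (auto intro!: tangential_zero)
  \<comment> \<open>Cramer's rule for the two orthogonality relations; the determinant is twice the
    signed area.\<close>
  then have "Im (cnj (Q - P) * (R - P)) * Re (g P) = 0" "Im (cnj (Q - P) * (R - P)) * Im (g P) = 0"
    by (simp_all add: inner_complex_def) algebra+
  then have "g P = 0"
    using nc by (simp add: collinear_iff_Im complex_eq_iff)
  moreover have "P \<in> K" by (simp add: tri hull_inc)
  ultimately show False
    using max_gradient_nonzero[of P] max p by simp
qed

text \<open>Read from \<open>Q\<close>, the parameters \<open>s\<close> and \<open>\<eta>\<close>
  become 1 - s and 1 - \<eta>. Excluding both ends leaves exactly min(1/2, \<eta>) \<le> s \<le>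
  max(1/2, \<eta>). The length bounds come from comparing \<open>PQ\<close> with its neighbour at
  each endpoint.\<close>

lemma max_gradient_location:
  assumes tri: "K = convex hull {P, Q, R}" and nc: "\<not> collinear {P, Q, R}"
    and p: "p \<in> closed_segment P Q" and max: "\<And>z. z \<in> K \<Longrightarrow> norm (g z) \<le> norm (g p)"
  shows "dist Q R \<le> dist P Q" "dist R P \<le> dist P Q"
    and "\<exists>\<eta>. (R - (P + of_real \<eta> * (Q - P))) \<bullet> (Q - P) = 0 \<and>
      p \<in> closed_segment (midpoint P Q) (P + of_real \<eta> * (Q - P))"
proof -
  have tri': "K = convex hull {Q, P, R}" and nc': "\<not> collinear {Q, P, R}"
    using tri nc by (simp_all add: insert_commute)
  have "p \<noteq> P" "p \<noteq> Q"
    using max_gradient_not_vertex[OF tri nc max] max_gradient_not_vertex[OF tri' nc' max] by auto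
  with p have po: "p \<in> open_segment P Q" by (simp add: open_segment_def)
  then have po': "p \<in> open_segment Q P" by (simp add: open_segment_commute)
  show "dist R P \<le> dist P Q"
    using gradient_less_short_side[OF tri nc _ po] max by (force simp: dist_commute)
  show "dist Q R \<le> dist P Q"
    using gradient_less_short_side[OF tri' nc' _ po'] max by (force simp: dist_commute)
  define D where "D = Q - P"
  obtain s where s: "0 < s" "s < 1" "p = P + of_real s * D"
    using po by (auto simp: in_segment D_def scaleR_conv_of_real algebra_simps)
  have D0: "D \<bullet> D \<noteq> 0" using po by (auto simp: D_def)
  define \<eta> where "\<eta> = ((R - P) \<bullet> D) / (D \<bullet> D)"
  have foot: "(R - P - of_real \<eta> * D) \<bullet> D = 0"
    unfolding scaleR_conv_of_real[symmetric] using D0 by (simp add: \<eta>_def inner_diff_left)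
  have foot': "(R - Q - of_real (1 - \<eta>) * (P - Q)) \<bullet> (P - Q) = 0"
  proof -
    have "R - Q - of_real (1 - \<eta>) * (P - Q) = R - P - of_real \<eta> * D" "P - Q = - D"
      by (simp_all add: D_def algebra_simps)
    then show ?thesis using foot by (simp only: inner_minus_right)
  qed
  have p': "p = Q + of_real (1 - s) * (P - Q)"
    by (simp add: s D_def algebra_simps)
  have "\<not> (s < 1 / 2 \<and> s < \<eta>)"
    using gradient_less_near_vertex[OF tri nc s(1) _ _ foot[unfolded D_def]] max
    unfolding D_def[symmetric] s(3)[symmetric] by force
  moreover have "\<not> (1 - s < 1 / 2 \<and> 1 - s < 1 - \<eta>)"
    using gradient_less_near_vertex[OF tri' nc' _ _ _ foot', of "1 - s"] max s(2)
    unfolding p'[symmetric] by force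
  ultimately have "s \<in> closed_segment (1 / 2) \<eta>"
    by (auto simp: closed_segment_eq_real_ivl)
  then obtain u where u: "0 \<le> u" "u \<le> 1" "s = (1 - u) * (1 / 2) + u * \<eta>"
    by (auto simp: in_segment)
  have "p \<in> closed_segment (midpoint P Q) (P + of_real \<eta> * D)"
    unfolding in_segment
    by (rule exI[of _ u]) (use u(1,2) in \<open>simp add: s(3) u(3) midpoint_def D_def scaleR_conv_of_real field_simps\<close>)
  with foot show "\<exists>\<eta>. (R - (P + of_real \<eta> * (Q - P))) \<bullet> (Q - P) = 0 \<and>
      p \<in> closed_segment (midpoint P Q) (P + of_real \<eta> * (Q - P))"
    unfolding D_def by (metis diff_diff_eq)
qed

end

section \<open>Transfer to the Euclidean plane\<close>

text \<open>Harmonicity of \<open>U + \<bar>z\<bar>\<^sup>2 / 4\<close> and symmetry of its Hessian are the Cauchy-Riemann equations for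
  the conjugate of its gradient.\<close>

lemma torsion_holomorphic_potential:
  fixes U :: "complex \<Rightarrow> real" and g :: "complex \<Rightarrow> complex"
  assumes T: "open T" "convex T"
    and U: "\<And>z. z \<in> T \<Longrightarrow> (U has_derivative (\<lambda>h. h \<bullet> g z)) (at z)"
    and g: "\<And>z. z \<in> T \<Longrightarrow> (g has_derivative E z) (at z)"
    and lap: "\<And>z. z \<in> T \<Longrightarrow> Re (E z 1) + Im (E z \<i>) = -1"
  shows "\<exists>F. F holomorphic_on T \<and> (\<forall>z\<in>T. U z = Re (F z) - (norm z)\<^sup>2 / 4)"
proof -
  \<comment> \<open>The gradient of U + |z|^2 / 4 is g + z / 2, and the gradient of Re F is the
    conjugate of F'; so \<open>f\<close> is the derivative that \<open>F\<close> must have.\<close>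
  define f where "f z = cnj (g z) + cnj z / 2" for z
  have f: "(f has_field_derivative (cnj (E z 1) + 1 / 2)) (at z)" if z: "z \<in> T" for z
  proof -
    interpret E: bounded_linear "E z"
      using g[OF z] by (rule has_derivative_bounded_linear)
    have sym: "Re (E z \<i>) = Im (E z 1)"
      using symmetric_second_derivative[OF T(1) z U g[OF z], of 1 \<i>] by (simp add: inner_complex_def)
    have "(f has_derivative (\<lambda>h. cnj (E z h) + cnj h / 2)) (at z)"
      unfolding f_def by (auto intro!: derivative_eq_intros has_derivative_cnj g z)
    moreover have "cnj (E z h) + cnj h / 2 = (cnj (E z 1) + 1 / 2) * h" for h
    proof -
      have "h = Re h *\<^sub>R 1 + Im h *\<^sub>R \<i>"
        by (simp add: complex_eq_iff)
      then have "E z h = Re h *\<^sub>R E z 1 + Im h *\<^sub>R E z \<i>"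
        by (metis E.add E.scaleR)
      then show ?thesis
        using lap[OF z] sym by (auto simp: complex_eq_iff algebra_simps) (algebra | argo)+
    qed
    ultimately show ?thesis
      unfolding has_field_derivative_def by (simp add: fun_eq_iff)
  qed
  then have "f holomorphic_on T"
    using T by (auto simp: holomorphic_on_open)
  then obtain F where "\<And>z. z \<in> T \<Longrightarrow> (F has_field_derivative f z) (at z within T)"
    using holomorphic_convex_primitive'[OF T(2,1)] by metis
  then have F: "(F has_field_derivative f z) (at z)" if "z \<in> T" for z
    using that T by (metis at_within_open)
  have "((\<lambda>z. U z - (Re (F z) - (z \<bullet> z) / 4)) has_derivative (\<lambda>h. 0)) (at z within T)" if z: "z \<in> T" for z
  proof -
    have "((\<lambda>z. U z - (Re (F z) - (z \<bullet> z) / 4)) has_derivative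
        (\<lambda>h. h \<bullet> g z - (Re (f z * h) - (h \<bullet> z) / 2))) (at z)"
      using F[OF z] unfolding has_field_derivative_def
      by (auto intro!: derivative_eq_intros U[OF z] simp: inner_commute)
    moreover have "h \<bullet> g z - (Re (f z * h) - (h \<bullet> z) / 2) = 0" for h
      by (simp add: f_def inner_complex_def field_simps)
    ultimately show ?thesis
      by (simp add: has_derivative_at_withinI)
  qed
  then have "\<exists>c. \<forall>z\<in>T. U z - (Re (F z) - (z \<bullet> z) / 4) = c"
    by (rule has_derivative_zero_constant[OF T(2)])
  then obtain c where c: "\<And>z. z \<in> T \<Longrightarrow> U z - (Re (F z) - (z \<bullet> z) / 4) = c"
    by blast
  have "F holomorphic_on T"
    using F T by (auto simp: holomorphic_on_open)
  then have "(\<lambda>z. F z + of_real c) holomorphic_on T"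
    by (intro holomorphic_intros)
  moreover have "U z = Re (F z + of_real c) - (norm z)\<^sup>2 / 4" if "z \<in> T" for z
    using c[OF that] by (simp add: dot_square_norm)
  ultimately show ?thesis by (intro exI[of _ "\<lambda>z. F z + of_real c"]) auto
qed

definition vec2 :: "complex \<Rightarrow> real^2" where "vec2 z = vector [Re z, Im z]"

definition cpx :: "real^2 \<Rightarrow> complex" where "cpx x = Complex (x $ 1) (x $ 2)"

lemma vec2_nth [simp]: "vec2 z $ 1 = Re z" "vec2 z $ 2 = Im z"
  by (simp_all add: vec2_def)

lemma cpx_sel [simp]: "Re (cpx x) = x $ 1" "Im (cpx x) = x $ 2"
  by (simp_all add: cpx_def)

lemma vec2_cpx [simp]: "vec2 (cpx x) = x" and cpx_vec2 [simp]: "cpx (vec2 z) = z"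
  by (simp_all add: vec_eq_iff forall_2 complex_eq_iff)

lemma inner_vec2: "vec2 z \<bullet> x = z \<bullet> cpx x"
  by (simp add: inner_vec_def sum_2 inner_complex_def)

lemma linear_vec2: "linear vec2" and linear_cpx: "linear cpx"
  by (auto intro!: linearI simp: vec_eq_iff forall_2 complex_eq_iff)

lemma bounded_linear_vec2: "bounded_linear vec2" and bounded_linear_cpx: "bounded_linear cpx"
  by (simp_all add: linear_vec2 linear_cpx linear_conv_bounded_linear[symmetric])

lemma bij_vec2: "bij vec2"
  by (rule bijI') (metis cpx_vec2, metis vec2_cpx)

lemma norm_cpx [simp]: "norm (cpx x) = norm x"
  by (metis inner_vec2 norm_eq_sqrt_inner vec2_cpx)

lemma dist_cpx [simp]: "dist (cpx x) (cpx y) = dist x y"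
  by (metis dist_norm linear_cpx linear_diff norm_cpx)

lemma has_derivative_gradient:
  assumes "u differentiable (at x)"
  shows "(u has_derivative (\<lambda>h. h \<bullet> gradient u x)) (at x)"
proof -
  have d: "(u has_derivative frechet_derivative u (at x)) (at x)"
    using assms by (simp add: frechet_derivative_works)
  interpret D: bounded_linear "frechet_derivative u (at x)"
    using d by (rule has_derivative_bounded_linear)
  have "frechet_derivative u (at x) h = h \<bullet> gradient u x" for h
  proof -
    have "h = h $ 1 *\<^sub>R axis 1 1 + h $ 2 *\<^sub>R axis 2 1"
      by (simp add: vec_eq_iff forall_2 axis_def)
    then have "frechet_derivative u (at x) h
      = h $ 1 *\<^sub>R frechet_derivative u (at x) (axis 1 1) + h $ 2 *\<^sub>R frechet_derivative u (at x) (axis 2 1)"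
      by (metis D.add D.scaleR)
    then show ?thesis
      by (simp add: gradient_def inner_vec_def sum_2)
  qed
  then have "frechet_derivative u (at x) = (\<lambda>h. h \<bullet> gradient u x)"
    by (rule ext)
  with d show ?thesis by simp
qed

text \<open>The coordinate map is a linear bijection and an isometry, so hull, interior, closure,
  frontier and gradient all carry over to the complex plane.\<close>

lemma torsion_of_torsion_function:
  assumes nc: "\<not> collinear {A, B, C}" and u: "torsion_function (open_triangle A B C) u"
    and G: "continuous_on (closure (open_triangle A B C)) G"
      "\<And>x. x \<in> open_triangle A B C \<Longrightarrow> G x = gradient u x"
  defines "K \<equiv> convex hull {cpx A, cpx B, cpx C}"
  shows "\<not> collinear {cpx A, cpx B, cpx C}" "closure (open_triangle A B C) = vec2 ` K"
    and "\<exists>F. torsion K (u \<circ> vec2) F (cpx \<circ> G \<circ> vec2)"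
proof -
  let ?H = "convex hull {A, B, C}" and ?T = "interior K"
  show nc': "\<not> collinear {cpx A, cpx B, cpx C}"
  proof
    assume "collinear {cpx A, cpx B, cpx C}"
    then obtain d where d: "\<And>x y. x \<in> {cpx A, cpx B, cpx C} \<Longrightarrow> y \<in> {cpx A, cpx B, cpx C} \<Longrightarrow> \<exists>c. x - y = c *\<^sub>R d"
      unfolding collinear_def by blast
    have "\<exists>c. x - y = c *\<^sub>R vec2 d" if "x \<in> {A, B, C}" "y \<in> {A, B, C}" for x y
    proof -
      obtain c where "cpx x - cpx y = c *\<^sub>R d"
        using d[of "cpx x" "cpx y"] \<open>x \<in> _\<close> \<open>y \<in> _\<close> by auto
      then have "vec2 (cpx x - cpx y) = c *\<^sub>R vec2 d"
        by (simp add: linear_cmul[OF linear_vec2])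
      then show ?thesis
        by (metis linear_diff[OF linear_vec2] vec2_cpx)
    qed
    with nc show False unfolding collinear_def by blast
  qed
  have HK: "?H = vec2 ` K"
    unfolding K_def convex_hull_linear_image[OF linear_vec2] by simp
  have ot: "open_triangle A B C = vec2 ` ?T"
    unfolding open_triangle_def HK by (rule interior_bijective_linear_image[OF linear_vec2 bij_vec2])
  have ne: "?T \<noteq> {}"
  proof -
    have "(1/3) *\<^sub>R cpx A + (1/3) *\<^sub>R cpx B + (1/3) *\<^sub>R cpx C \<in> ?T"
      unfolding K_def interior_convex_hull_3_minimal[OF nc' DIM_complex]
      by (intro CollectI exI[of _ "1/3"]) simp
    then show ?thesis by blast
  qed
  have K: "compact K" "convex K"
    unfolding K_def by (auto intro: compact_convex_hull finite_imp_compact)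
  have ne': "interior ?H \<noteq> {}"
    using ot ne by (simp add: open_triangle_def)
  have cl: "closure (open_triangle A B C) = ?H"
    unfolding open_triangle_def
    by (simp add: convex_closure_interior[OF _ ne'] compact_convex_hull finite_imp_compact compact_imp_closed)
  with HK show clK: "closure (open_triangle A B C) = vec2 ` K" by simp
  have fr: "frontier (open_triangle A B C) = vec2 ` frontier K"
  proof -
    have "frontier (open_triangle A B C) = vec2 ` K - vec2 ` ?T"
      unfolding frontier_def clK by (simp add: open_triangle_def interior_open flip: ot)
    also have "\<dots> = vec2 ` frontier K"
      using K bij_vec2 by (simp add: frontier_def compact_imp_closed image_set_diff bij_is_inj)
    finally show ?thesis .
  qed
  have cv: "continuous_on S vec2" and cc: "continuous_on S' cpx" for S S'
    by (simp_all add: bounded_linear_vec2 bounded_linear_cpx linear_continuous_on)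
  note u' = u[unfolded torsion_function_def C2_on_def]
  have der: "((u \<circ> vec2) has_derivative (\<lambda>h. h \<bullet> cpx (gradient u (vec2 z)))) (at z)" if z: "z \<in> ?T" for z
  proof -
    have "u differentiable (at (vec2 z))" using u' z ot by auto
    from has_derivative_gradient[OF this]
    show ?thesis
      using has_derivative_compose[OF bounded_linear_imp_has_derivative[OF bounded_linear_vec2], where g = u]
      by (fastforce simp: o_def inner_vec2)
  qed
  have "\<exists>F. F holomorphic_on ?T \<and> (\<forall>z\<in>?T. (u \<circ> vec2) z = Re (F z) - (norm z)\<^sup>2 / 4)"
  proof (rule torsion_holomorphic_potential)
    fix z assume z: "z \<in> ?T"
    then have zt: "vec2 z \<in> open_triangle A B C" using ot by auto
    let ?D = "frechet_derivative (gradient u) (at (vec2 z))"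
    show "((u \<circ> vec2) has_derivative (\<lambda>h. h \<bullet> cpx (gradient u (vec2 z)))) (at z)"
      by (rule der[OF z])
    have "(gradient u has_derivative ?D) (at (vec2 z))"
      using u' zt by (auto simp: frechet_derivative_works)
    then have "((\<lambda>z. gradient u (vec2 z)) has_derivative (\<lambda>h. ?D (vec2 h))) (at z)"
      by (rule has_derivative_compose[OF bounded_linear_imp_has_derivative[OF bounded_linear_vec2]])
    then show "((\<lambda>z. cpx (gradient u (vec2 z))) has_derivative (\<lambda>h. cpx (?D (vec2 h)))) (at z)"
      by (rule bounded_linear.has_derivative[OF bounded_linear_cpx])
    \<comment> \<open>The numbers 1 and \<i> correspond to the coordinate axes, so the trace of the
      Hessian becomes the hypothesis \<open>lap\<close> of the potential lemma.\<close>
    have "vec2 1 = axis 1 1" "vec2 \<i> = axis 2 1"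
      by (simp_all add: vec_eq_iff forall_2 axis_def)
    moreover have "laplacian u (vec2 z) = -1"
      using u' zt by force
    ultimately show "Re (cpx (?D (vec2 1))) + Im (cpx (?D (vec2 \<i>))) = -1"
      by (simp add: laplacian_def sum_2)
  qed (use K in \<open>auto simp: convex_interior\<close>)
  then obtain F where F: "F holomorphic_on ?T" "\<And>z. z \<in> ?T \<Longrightarrow> (u \<circ> vec2) z = Re (F z) - (norm z)\<^sup>2 / 4"
    by blast
  have "torsion K (u \<circ> vec2) F (cpx \<circ> G \<circ> vec2)"
  proof
    show "continuous_on K (u \<circ> vec2)"
      using u' clK by (intro continuous_on_compose cv) auto
    show "continuous_on K (cpx \<circ> G \<circ> vec2)"
      using G(1) clK by (intro continuous_on_compose cv cc) auto
    show "(u \<circ> vec2) z = 0" if "z \<in> frontier K" for z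
      using u' fr that by auto
    show "((u \<circ> vec2) has_derivative (\<lambda>h. h \<bullet> (cpx \<circ> G \<circ> vec2) z)) (at z)" if "z \<in> ?T" for z
      using der[OF that] G(2)[of "vec2 z"] that ot by simp
  qed (use K ne F in auto)
  then show "\<exists>F. torsion K (u \<circ> vec2) F (cpx \<circ> G \<circ> vec2)" by blast
qed

theorem theorem1p3:
  fixes A B C p :: "real^2"
  assumes "\<not> collinear {A, B, C}"
    and "fail_point (open_triangle A B C) p"
  shows "\<exists>P Q R H. {P, Q, R} = {A, B, C} \<and>
    dist Q R \<le> dist P Q \<and> dist R P \<le> dist P Q \<and>
    altitude_foot R P Q H \<and>
    p \<in> closed_segment P Q \<and> p \<in> closed_segment (midpoint P Q) H"
proof -
  obtain u G where u: "torsion_function (open_triangle A B C) u"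
    and G: "continuous_on (closure (open_triangle A B C)) G"
      "\<And>x. x \<in> open_triangle A B C \<Longrightarrow> G x = gradient u x"
    and p: "p \<in> closure (open_triangle A B C)"
    and max: "\<And>q. q \<in> closure (open_triangle A B C) \<Longrightarrow> norm (G q) \<le> norm (G p)"
    using assms(2) by (auto simp: fail_point_def)
  define K where "K = convex hull {cpx A, cpx B, cpx C}"
  note T = torsion_of_torsion_function[OF assms(1) u G, folded K_def]
  obtain F where "torsion K (u \<circ> vec2) F (cpx \<circ> G \<circ> vec2)"
    using T(3) by blast
  then interpret torsion K "u \<circ> vec2" F "cpx \<circ> G \<circ> vec2" .
  have pK: "cpx p \<in> K"
    using p T(2) by auto
  have max': "norm ((cpx \<circ> G \<circ> vec2) z) \<le> norm ((cpx \<circ> G \<circ> vec2) (cpx p))" if "z \<in> K" for z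
    using max[of "vec2 z"] that T(2) by auto
  have seg_iff: "x \<in> closed_segment a b \<longleftrightarrow> cpx x \<in> closed_segment (cpx a) (cpx b)" for x a b
    unfolding closed_segment_linear_image[OF linear_cpx] by (metis image_iff vec2_cpx)
  \<comment> \<open>The side is not chosen as a longest one: \<open>p\<close> lies on some side, and
    maximality of the gradient at \<open>p\<close> forces that side to have maximal length. Cyclic
    relabelling then covers all three sides.\<close>
  have side: ?thesis if PQR: "{P, Q, R} = {A, B, C}" and pPQ: "cpx p \<in> closed_segment (cpx P) (cpx Q)" for P Q R
  proof -
    have im: "{cpx P, cpx Q, cpx R} = {cpx A, cpx B, cpx C}"
      using arg_cong[OF PQR, of "image cpx"] by simp
    have tri: "K = convex hull {cpx P, cpx Q, cpx R}" and nc: "\<not> collinear {cpx P, cpx Q, cpx R}"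
      unfolding im K_def using T(1) by auto
    note loc = max_gradient_location[OF tri nc pPQ max']
    obtain \<eta> where \<eta>: "(cpx R - (cpx P + of_real \<eta> * (cpx Q - cpx P))) \<bullet> (cpx Q - cpx P) = 0"
      "cpx p \<in> closed_segment (midpoint (cpx P) (cpx Q)) (cpx P + of_real \<eta> * (cpx Q - cpx P))"
      using loc(3) by blast
    define H where "H = (1 - \<eta>) *\<^sub>R P + \<eta> *\<^sub>R Q"
    have H: "cpx H = cpx P + of_real \<eta> * (cpx Q - cpx P)"
      by (simp add: H_def complex_eq_iff algebra_simps)
    have "altitude_foot R P Q H"
      unfolding altitude_foot_def orthogonal_def
    proof
      show "H \<in> affine hull {P, Q}"
        unfolding affine_hull_2 H_def by (intro CollectI exI[of _ "1 - \<eta>"] exI[of _ \<eta>]) simp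
      show "(R - H) \<bullet> (Q - P) = 0"
        using \<eta>(1) unfolding H[symmetric]
        by (metis inner_vec2 linear_cpx linear_diff vec2_cpx)
    qed
    moreover have "p \<in> closed_segment (midpoint P Q) H"
      using \<eta>(2) unfolding seg_iff H midpoint_linear_image[OF linear_cpx] .
    ultimately show ?thesis
      using PQR loc(1,2) pPQ by (metis dist_cpx seg_iff)
  qed
  have "cpx p \<in> frontier K"
    using max_gradient_frontier[OF pK max'] .
  then consider "cpx p \<in> closed_segment (cpx A) (cpx B)" | "cpx p \<in> closed_segment (cpx B) (cpx C)" | "cpx p \<in> closed_segment (cpx C) (cpx A)"
    unfolding K_def using frontier_of_triangle[of "cpx A" "cpx B" "cpx C"] by auto
  then show ?thesis
    using side[of A B C] side[of B C A] side[of C A B] by cases (simp_all add: insert_commute)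
qed

end
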